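(* Let $\mathcal{X}$ be a symplectic manifold with the Ether structure and quantization data described in the context. Let $H$ be a function on $\mathcal{X}$, $\widehat H$ the corresponding quantum operator, and $X^t$ the Hamilton flow of $H$. For $y\in\mathcal{X}$ let $$\widehat U^t_y=\exp\Big\{-\frac{i}{\hbar}H(y)t\Big\}\,\widehat U_{X^t(y)},$$ where $\widehat U_{X^t(y)}$ is the quantum path corresponding to the trajectory segment $\{X^\tau(y)\mid0\le\tau\le t\}$ (this operator is called the quantum translocation). Then the following permutation formula holds: $$\Big(-i\hbar\frac{\partial}{\partial t}+\widehat H\Big)\cdot\widehat U^t_y=\widehat U^t_y\cdot\Big(-i\hbar\frac{\partial}{\partial t}+\widehat{\mathbf{H}}^t_y\Big),$$ where $$\mathbf{H}^t_y=\widehat{X^t(y)}^*\Big(H-\frac12\,\dot X^t(y)\,\mathcal{H}^\hbar_{X^t(y)}\Big)-H(y).$$ The quantum translocated Hamiltonian $\mathbf{H}^t_y$ differs from the classical translocated Hamiltonian $$H^t_y=[X^t(y)]^*\Big(H-\frac12\,\dot X^t(y)\,\mathcal{H}_{X^t(y)}\Big)-H(y)$$ by $O(\hbar^2)$: $$\mathbf{H}^t_y=H^t_y+O(\hbar^2)\qquad\text{as }\hbar\to0 .$$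
   Context: Classical data. $\mathcal{X}$ carries a symplectic form $\omega$ and a torsion-free connection $\Gamma$ with $\nabla\omega=0$, $\dim\mathcal{X}=2n$; $\Psi=\omega^{-1}$, $\omega_{kj}\Psi^{jm}=\delta^m_k$, $\{f,g\}=\partial_jf\,\Psi^{jk}\,\partial_kg$. The Hamilton flow $X^t$ of $H$ is given by $\frac{d}{dt}X^m=\partial_jH(X)\Psi^{jm}(X)$, $X|_{t=0}=x$. An Ether Hamiltonian $\mathcal{H}_x(z)=\sum_j\mathcal{H}_x(z)_j\,dx^j$ is a 1-form on $\mathcal{X}$ with values in smooth real functions on $\mathcal{X}$ with: (a) $\partial\mathcal{H}+\frac12\{\mathcal{H}\wedge\mathcal{H}\}=0$, i.e. $\partial_{x^j}\mathcal{H}_k-\partial_{x^k}\mathcal{H}_j+\{\mathcal{H}_j,\mathcal{H}_k\}=0$ ($\partial=d_x$, brackets in $z$); (b) on $z=x$: $\mathcal{H}=0$, $\nabla\mathcal{H}=2\omega$ (i.e. $\nabla_j\mathcal{H}_k=2\omega_{kj}$), $\nabla\nabla\mathcal{H}=0$, $\nabla=\nabla_z$; (c) $\mathcal{H}_x(s_x(z))=-\mathcal{H}_x(z)$, where $s=s_x(z)$ solves $\partial s=\nabla\mathcal{H}(s)\Psi(s)$, $s|_{x=z}=z$. The symplectic path $[\sigma]:\mathcal{X}\to\mathcal{X}$ for $\sigma=\{y(t)\}$ is the translation over the whole path along the trajectories of $\dot Y^m=\frac12\dot y^k(t)\,\partial_j\mathcal{H}_{y(t)}(Y)_k\,\Psi^{jm}(Y)$;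 $[X^t(y)]$ is the one for the segment $\{X^\tau(y)\mid0\le\tau\le t\}$. $\dot X^t(y)\mathcal{H}_{X^t(y)}$ denotes the function $\sum_k\dot X^t(y)^k\,\mathcal{H}_{X^t(y)}(\cdot)_k$, and similarly for $\mathcal{H}^\hbar$. Quantum data. There is a representation of functions on $\mathcal{X}$ in a Hilbert space, $f\mapsto\hat f=\frac1{(2\pi\hbar)^n}\int_{\mathcal{X}}f\,\mathbf{S}\,dm$ ($dm$ a measure on $\mathcal{X}$), where the operators $\mathbf{S}_x$ obey $i\hbar\,\partial\mathbf{S}=\widehat{\mathcal{H}}^\hbar\mathbf{S}$ with a quantum intrinsic Hamiltonian $\mathcal{H}^\hbar$ (a 1-form on $\mathcal{X}$ with values in functions) such that $\partial\widehat{\mathcal{H}}^\hbar+\frac{i}{2\hbar}[\widehat{\mathcal{H}}^\hbar\wedge\widehat{\mathcal{H}}^\hbar]=0$, $(\widehat{\mathcal{H}}^\hbar)^*=\widehat{\mathcal{H}}^\hbar$, $\mathbf{S}_x^*=\mathbf{S}_x$, $\mathbf{S}_x^2=\mu^2I$ with $\mu=\mathrm{const}$, and $\mathcal{H}^\hbar=\mathcal{H}+O(\hbar^2)$. The product $*$ is defined by $\hat f\hat g=\widehat{f*g}$. The quantum path corresponding to $\sigma=\{y(t)\}$ is the unitary operator $\widehat U_\sigma=\underset{\leftarrow}{\mathrm{Exp}}\big(-\frac{i}{2\hbar}\int_\sigma\widehat{\mathcal{H}}^\hbar\big)$, the value at the end of the path of the solution of $i\hbar\frac{d}{dt}\widehat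 U=\frac12\dot y^k(t)\widehat{\mathcal{H}}^\hbar_{y(t)k}\widehat U$, $\widehat U=I$ at the origin. The mapping $\hat\sigma^*$ acting on functions is defined by $\widehat U_\sigma^{-1}\cdot\hat f\cdot\widehat U_\sigma=\widehat{\hat\sigma^*f}$; it has the expansion $\hat\sigma^*=[\sigma]^*(I+O(\hbar^2))$. $\widehat{X^t(y)}^*$ denotes $\hat\sigma^*$ for the segment $\sigma=\{X^\tau(y)\mid0\le\tau\le t\}$. *)

theory Defs
  imports "HOL-Analysis.Analysis"
begin

section \<open>Complex Hilbert spaces\<close>

text \<open>The topology and the real Hilbert space structure are those of the library classes; the
  inner product is linear in its second argument.\<close>

class complex_hilbert_space = real_inner + complete_space +
  fixes scaleC :: "complex \<Rightarrow> 'a \<Rightarrow> 'a" (infixr "*\<^sub>C" 75)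
    and cinner :: "'a \<Rightarrow> 'a \<Rightarrow> complex"
  assumes scaleC_add_right: "a *\<^sub>C (u + v) = a *\<^sub>C u + a *\<^sub>C v"
    and scaleC_add_left: "(a + b) *\<^sub>C u = a *\<^sub>C u + b *\<^sub>C u"
    and scaleC_scaleC: "a *\<^sub>C (b *\<^sub>C u) = (a * b) *\<^sub>C u"
    and scaleR_scaleC: "r *\<^sub>R u = complex_of_real r *\<^sub>C u"
    and cinner_commute: "cinner u v = cnj (cinner v u)"
    and cinner_add_right: "cinner u (v + w) = cinner u v + cinner u w"
    and cinner_scaleC_right: "cinner u (a *\<^sub>C v) = a * cinner u v"
    and Re_cinner: "Re (cinner u v) = inner u v"

definition complex_linear :: "('h::complex_hilbert_space \<Rightarrow> 'h) \<Rightarrow> bool" where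
  "complex_linear T \<longleftrightarrow> (\<forall>u v. T (u + v) = T u + T v) \<and> (\<forall>a u. T (a *\<^sub>C u) = a *\<^sub>C T u)"

definition unitary_operator :: "('h::complex_hilbert_space \<Rightarrow> 'h) \<Rightarrow> bool" where
  "unitary_operator U \<longleftrightarrow> complex_linear U \<and> surj U \<and> (\<forall>u v. cinner (U u) (U v) = cinner u v)"

definition dense_subspace :: "'h::complex_hilbert_space set \<Rightarrow> bool" where
  "dense_subspace D \<longleftrightarrow> 0 \<in> D \<and> (\<forall>u\<in>D. \<forall>v\<in>D. u + v \<in> D) \<and> (\<forall>a. \<forall>u\<in>D. a *\<^sub>C u \<in> D)
     \<and> closure D = UNIV"


section \<open>Smooth manifolds in coordinates\<close>

definition dir_deriv ::
  "'a::real_normed_vector \<Rightarrow> ('a \<Rightarrow> 'b::real_normed_vector) \<Rightarrow> 'a \<Rightarrow> 'b" where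
  "dir_deriv v f u = frechet_derivative f (at u) v"

primrec dir_derivs ::
  "'a::real_normed_vector list \<Rightarrow> ('a \<Rightarrow> 'b::real_normed_vector) \<Rightarrow> 'a \<Rightarrow> 'b" where
  "dir_derivs [] f = f"
| "dir_derivs (v # vs) f = dir_deriv v (dir_derivs vs f)"

text \<open>Infinite differentiability, for an open set and a finite-dimensional domain: all iterated
  directional derivatives exist and are differentiable.\<close>

definition smooth_on :: "'a::real_normed_vector set \<Rightarrow> ('a \<Rightarrow> 'b::real_normed_vector) \<Rightarrow> bool" where
  "smooth_on A f \<longleftrightarrow> (\<forall>vs. \<forall>u\<in>A. dir_derivs vs f differentiable (at u))"

text \<open>A chart is an open set with a coordinate map; the index type of the coordinates has
  cardinality equal to the dimension. The manifold is the whole type \<open>'x\<close> with an atlas.\<close>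

type_synonym ('x, 'd) chart = "'x set \<times> ('x \<Rightarrow> real^'d)"

abbreviation cdom :: "('x, 'd) chart \<Rightarrow> 'x set" where
  "cdom c \<equiv> fst c"

abbreviation cmap :: "('x, 'd) chart \<Rightarrow> 'x \<Rightarrow> real^'d" where
  "cmap c \<equiv> snd c"

definition crange :: "('x, 'd) chart \<Rightarrow> (real^'d) set" where
  "crange c = cmap c ` cdom c"

definition cinv :: "('x, 'd) chart \<Rightarrow> real^'d \<Rightarrow> 'x" where
  "cinv c = inv_into (cdom c) (cmap c)"

definition smooth_atlas ::
  "('x::{second_countable_topology, t2_space}, 'd::finite) chart set \<Rightarrow> bool" where
  "smooth_atlas A \<longleftrightarrow>
     (\<forall>c\<in>A. open (cdom c) \<and> open (crange c) \<and> homeomorphism (cdom c) (crange c) (cmap c) (cinv c))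
     \<and> (\<Union>c\<in>A. cdom c) = UNIV
     \<and> (\<forall>a\<in>A. \<forall>b\<in>A. smooth_on (cmap a ` (cdom a \<inter> cdom b)) (cmap b \<circ> cinv a))"

text \<open>The coordinate derivative of a function on the manifold along the \<open>j\<close>-th coordinate.\<close>

definition pderiv_chart ::
  "('x, 'd::finite) chart \<Rightarrow> 'd \<Rightarrow> ('x \<Rightarrow> 'b::real_normed_vector) \<Rightarrow> 'x \<Rightarrow> 'b" where
  "pderiv_chart c j f p = dir_deriv (axis j 1) (f \<circ> cinv c) (cmap c p)"

definition smooth_fun ::
  "('x, 'd::finite) chart set \<Rightarrow> ('x \<Rightarrow> 'b::real_normed_vector) \<Rightarrow> bool" where
  "smooth_fun A f \<longleftrightarrow> (\<forall>c\<in>A. smooth_on (crange c) (f \<circ> cinv c))"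

definition smooth_map ::
  "('x::topological_space, 'd::finite) chart set \<Rightarrow> ('x \<Rightarrow> 'x) \<Rightarrow> bool" where
  "smooth_map A f \<longleftrightarrow> continuous_on UNIV f \<and>
     (\<forall>a\<in>A. \<forall>b\<in>A. smooth_on (cmap a ` (cdom a \<inter> f -` cdom b)) (cmap b \<circ> f \<circ> cinv a))"

definition smooth_curve ::
  "('x::topological_space, 'd::finite) chart set \<Rightarrow> real set \<Rightarrow> (real \<Rightarrow> 'x) \<Rightarrow> bool" where
  "smooth_curve A J \<gamma> \<longleftrightarrow> continuous_on J \<gamma> \<and>
     (\<forall>c\<in>A. smooth_on (J \<inter> \<gamma> -` cdom c) (\<lambda>t. cmap c (\<gamma> t)))"

definition velocity :: "('x, 'd::finite) chart \<Rightarrow> (real \<Rightarrow> 'x) \<Rightarrow> real \<Rightarrow> real^'d" where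
  "velocity c \<gamma> t = vector_derivative (\<lambda>\<tau>. cmap c (\<gamma> \<tau>)) (at t)"

text \<open>A path is parametrized from its origin \<open>\<gamma> 0\<close> to its end \<open>\<gamma> T\<close>; \<open>T\<close> may be negative.\<close>

definition smooth_path ::
  "('x::topological_space, 'd::finite) chart set \<Rightarrow> (real \<Rightarrow> 'x) \<Rightarrow> real \<Rightarrow> bool" where
  "smooth_path A \<gamma> T \<longleftrightarrow> (\<exists>J. open J \<and> closed_segment 0 T \<subseteq> J \<and> smooth_curve A J \<gamma>)"

definition jacobian :: "('x, 'd::finite) chart \<Rightarrow> ('x, 'd) chart \<Rightarrow> 'x \<Rightarrow> 'd \<Rightarrow> 'd \<Rightarrow> real" where
  "jacobian a b p m j = pderiv_chart a j (\<lambda>q. cmap b q $ m) p"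

text \<open>A 1-form in \<open>x\<close> with values in functions of \<open>z\<close> is given by its components \<open>\<alpha> c x z $ k\<close> in
  every chart \<open>c\<close> around \<open>x\<close>, smooth in \<open>(x, z)\<close> and transforming as a covector.\<close>

definition function_valued_form ::
  "('x, 'd::finite) chart set \<Rightarrow> (('x, 'd) chart \<Rightarrow> 'x \<Rightarrow> 'x \<Rightarrow> 'b::real_normed_vector^'d) \<Rightarrow> bool"
  where
  "function_valued_form A \<alpha> \<longleftrightarrow>
     (\<forall>a\<in>A. \<forall>b\<in>A. smooth_on (crange a \<times> crange b) (\<lambda>(u, v). \<alpha> a (cinv a u) (cinv b v)))
     \<and> (\<forall>a\<in>A. \<forall>b\<in>A. \<forall>x\<in>cdom a \<inter> cdom b. \<forall>z j.
          \<alpha> a x z $ j = (\<Sum>m\<in>UNIV. jacobian a b x m j *\<^sub>R \<alpha> b x z $ m))"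


section \<open>Classical data\<close>

text \<open>\<open>symp M c p $ k $ j\<close> is the component \<open>\<omega>\<^sub>k\<^sub>j\<close> and \<open>christoffel M c p $ i $ j $ k\<close> the Christoffel
  symbol with upper index \<open>i\<close>; \<open>ether M c x z $ k\<close> is the \<open>k\<close>-th component of the Ether Hamiltonian
  at \<open>x\<close>, evaluated at \<open>z\<close>; \<open>reflection M x z\<close> is \<open>s\<^sub>x(z)\<close>.\<close>

record ('x, 'd::finite) ether_data =
  atlas :: "('x, 'd) chart set"
  symp :: "('x, 'd) chart \<Rightarrow> 'x \<Rightarrow> real^'d^'d"
  christoffel :: "('x, 'd) chart \<Rightarrow> 'x \<Rightarrow> real^'d^'d^'d"
  ether :: "('x, 'd) chart \<Rightarrow> 'x \<Rightarrow> 'x \<Rightarrow> real^'d"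
  reflection :: "'x \<Rightarrow> 'x \<Rightarrow> 'x"

definition symp_inv ::
  "('x, 'd::finite, 'm) ether_data_scheme \<Rightarrow> ('x, 'd) chart \<Rightarrow> 'x \<Rightarrow> real^'d^'d" where
  "symp_inv M c p = matrix_inv (symp M c p)"

definition poisson_bracket ::
  "('x, 'd::finite, 'm) ether_data_scheme \<Rightarrow> ('x, 'd) chart \<Rightarrow> ('x \<Rightarrow> real) \<Rightarrow> ('x \<Rightarrow> real) \<Rightarrow> 'x \<Rightarrow> real"
  where
  "poisson_bracket M c f g p =
     (\<Sum>j\<in>UNIV. \<Sum>k\<in>UNIV. pderiv_chart c j f p * symp_inv M c p $ j $ k * pderiv_chart c k g p)"

definition hessian_chart ::
  "('x, 'd::finite, 'm) ether_data_scheme \<Rightarrow> ('x, 'd) chart \<Rightarrow> 'd \<Rightarrow> 'd \<Rightarrow> ('x \<Rightarrow> real) \<Rightarrow> 'x \<Rightarrow> real"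
  where
  "hessian_chart M c i j f p =
     pderiv_chart c i (pderiv_chart c j f) p
       - (\<Sum>l\<in>UNIV. christoffel M c p $ l $ i $ j * pderiv_chart c l f p)"

text \<open>The local flow of \<open>H\<close>; \<open>I y\<close> is an open time interval on which the trajectory of \<open>y\<close> exists.\<close>

definition hamilton_flow ::
  "('x::topological_space, 'd::finite, 'm) ether_data_scheme \<Rightarrow> ('x \<Rightarrow> real) \<Rightarrow> ('x \<Rightarrow> real set)
     \<Rightarrow> (real \<Rightarrow> 'x \<Rightarrow> 'x) \<Rightarrow> bool" where
  "hamilton_flow M H I X \<longleftrightarrow> (\<forall>y.
     open (I y) \<and> is_interval (I y) \<and> 0 \<in> I y \<and> X 0 y = y
     \<and> smooth_curve (atlas M) (I y) (\<lambda>t. X t y)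
     \<and> (\<forall>t\<in>I y. \<forall>c\<in>atlas M. X t y \<in> cdom c \<longrightarrow> (\<forall>m.
          velocity c (\<lambda>\<tau>. X \<tau> y) t $ m
            = (\<Sum>j\<in>UNIV. pderiv_chart c j H (X t y) * symp_inv M c (X t y) $ j $ m))))"

locale symplectic_manifold =
  fixes M :: "('x::{second_countable_topology, t2_space}, 'd::finite, 'm) ether_data_scheme"
  assumes atlas: "smooth_atlas (atlas M)"
    and symp_smooth: "c \<in> atlas M \<Longrightarrow> smooth_on (crange c) (symp M c \<circ> cinv c)"
    and symp_tensor: "\<lbrakk>a \<in> atlas M; b \<in> atlas M; p \<in> cdom a \<inter> cdom b\<rbrakk> \<Longrightarrow>
      symp M a p $ j $ k =
        (\<Sum>m\<in>UNIV. \<Sum>l\<in>UNIV. jacobian a b p m j * jacobian a b p l k * symp M b p $ m $ l)"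
    and symp_antisym: "\<lbrakk>c \<in> atlas M; p \<in> cdom c\<rbrakk> \<Longrightarrow> symp M c p $ j $ k = - symp M c p $ k $ j"
    and symp_nondegenerate: "\<lbrakk>c \<in> atlas M; p \<in> cdom c\<rbrakk> \<Longrightarrow> invertible (symp M c p)"
    and symp_closed: "\<lbrakk>c \<in> atlas M; p \<in> cdom c\<rbrakk> \<Longrightarrow>
      pderiv_chart c i (\<lambda>q. symp M c q $ j $ k) p + pderiv_chart c j (\<lambda>q. symp M c q $ k $ i) p
        + pderiv_chart c k (\<lambda>q. symp M c q $ i $ j) p = 0"

locale symplectic_connection = symplectic_manifold M
  for M :: "('x::{second_countable_topology, t2_space}, 'd::finite, 'm) ether_data_scheme" +
  assumes christoffel_smooth: "c \<in> atlas M \<Longrightarrow> smooth_on (crange c) (christoffel M c \<circ> cinv c)"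
    and christoffel_transform: "\<lbrakk>a \<in> atlas M; b \<in> atlas M; p \<in> cdom a \<inter> cdom b\<rbrakk> \<Longrightarrow>
      (\<Sum>i\<in>UNIV. jacobian a b p m i * christoffel M a p $ i $ j $ k) =
        pderiv_chart a j (pderiv_chart a k (\<lambda>q. cmap b q $ m)) p
        + (\<Sum>l\<in>UNIV. \<Sum>r\<in>UNIV.
             jacobian a b p l j * jacobian a b p r k * christoffel M b p $ m $ l $ r)"
    and torsion_free: "\<lbrakk>c \<in> atlas M; p \<in> cdom c\<rbrakk> \<Longrightarrow>
      christoffel M c p $ i $ j $ k = christoffel M c p $ i $ k $ j"
    and symp_parallel: "\<lbrakk>c \<in> atlas M; p \<in> cdom c\<rbrakk> \<Longrightarrow>
      pderiv_chart c i (\<lambda>q. symp M c q $ j $ k) p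
        - (\<Sum>l\<in>UNIV. christoffel M c p $ l $ i $ j * symp M c p $ l $ k)
        - (\<Sum>l\<in>UNIV. christoffel M c p $ l $ i $ k * symp M c p $ j $ l) = 0"

locale ether_manifold = symplectic_connection M
  for M :: "('x::{second_countable_topology, t2_space}, 'd::finite, 'm) ether_data_scheme" +
  assumes ether_form: "function_valued_form (atlas M) (ether M)"
    and ether_flat: "\<lbrakk>c \<in> atlas M; x \<in> cdom c; b \<in> atlas M; z \<in> cdom b\<rbrakk> \<Longrightarrow>
      pderiv_chart c j (\<lambda>x. ether M c x z $ k) x - pderiv_chart c k (\<lambda>x. ether M c x z $ j) x
        + poisson_bracket M b (\<lambda>z. ether M c x z $ j) (\<lambda>z. ether M c x z $ k) z = 0"
    and ether_diag: "\<lbrakk>c \<in> atlas M; x \<in> cdom c\<rbrakk> \<Longrightarrow> ether M c x x $ k = 0"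
    and ether_deriv_diag: "\<lbrakk>c \<in> atlas M; x \<in> cdom c\<rbrakk> \<Longrightarrow>
      pderiv_chart c j (\<lambda>z. ether M c x z $ k) x = 2 * symp M c x $ k $ j"
    and ether_hessian_diag: "\<lbrakk>c \<in> atlas M; x \<in> cdom c\<rbrakk> \<Longrightarrow>
      hessian_chart M c i j (\<lambda>z. ether M c x z $ k) x = 0"
    and refl_smooth: "smooth_map (atlas M) (\<lambda>x. reflection M x z)"
    and refl_diag: "reflection M z z = z"
    and refl_eq: "\<lbrakk>c \<in> atlas M; x \<in> cdom c; b \<in> atlas M; reflection M x z \<in> cdom b\<rbrakk> \<Longrightarrow>
      pderiv_chart c k (\<lambda>x. cmap b (reflection M x z) $ m) x =
        (\<Sum>j\<in>UNIV. pderiv_chart b j (\<lambda>w. ether M c x w $ k) (reflection M x z)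
                    * symp_inv M b (reflection M x z) $ j $ m)"
    and ether_refl: "\<lbrakk>c \<in> atlas M; x \<in> cdom c\<rbrakk> \<Longrightarrow>
      ether M c x (reflection M x z) $ k = - ether M c x z $ k"

text \<open>Contractions of a 1-form with the velocity of a path do not depend on the chart, so any chart
  around the point may be used.\<close>

definition chart_at :: "('x, 'd::finite, 'm) ether_data_scheme \<Rightarrow> 'x \<Rightarrow> ('x, 'd) chart" where
  "chart_at M p = (SOME c. c \<in> atlas M \<and> p \<in> cdom c)"

definition contract_velocity ::
  "('x, 'd::finite, 'm) ether_data_scheme \<Rightarrow> (('x, 'd) chart \<Rightarrow> 'x \<Rightarrow> 'x \<Rightarrow> 'b::real_vector^'d)
     \<Rightarrow> (real \<Rightarrow> 'x) \<Rightarrow> real \<Rightarrow> 'x \<Rightarrow> 'b" where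
  "contract_velocity M \<alpha> \<gamma> t z =
     (let c = chart_at M (\<gamma> t) in \<Sum>k\<in>UNIV. velocity c \<gamma> t $ k *\<^sub>R \<alpha> c (\<gamma> t) z $ k)"

definition translation_trajectory ::
  "('x::topological_space, 'd::finite, 'm) ether_data_scheme \<Rightarrow> (real \<Rightarrow> 'x) \<Rightarrow> real
     \<Rightarrow> (real \<Rightarrow> 'x) \<Rightarrow> bool" where
  "translation_trajectory M \<gamma> T Y \<longleftrightarrow>
     continuous_on (closed_segment 0 T) Y \<and>
     (\<forall>t\<in>closed_segment 0 T. \<forall>a\<in>atlas M. \<forall>b\<in>atlas M. \<gamma> t \<in> cdom a \<longrightarrow> Y t \<in> cdom b \<longrightarrow>
        ((\<lambda>\<tau>. cmap b (Y \<tau>)) has_vector_derivative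
           (\<chi> m. 1/2 * (\<Sum>k\<in>UNIV. \<Sum>j\<in>UNIV. velocity a \<gamma> t $ k
                   * pderiv_chart b j (\<lambda>w. ether M a (\<gamma> t) w $ k) (Y t)
                   * symp_inv M b (Y t) $ j $ m)))
          (at t within closed_segment 0 T))"

definition symplectic_path ::
  "('x::topological_space, 'd::finite, 'm) ether_data_scheme \<Rightarrow> (real \<Rightarrow> 'x) \<Rightarrow> real \<Rightarrow> 'x \<Rightarrow> 'x" where
  "symplectic_path M \<gamma> T z = (THE w. \<exists>Y. translation_trajectory M \<gamma> T Y \<and> Y 0 = z \<and> Y T = w)"


section \<open>Quantum data\<close>

text \<open>\<open>hbars\<close> is the set of admissible values of the deformation parameter. For each value, \<open>core\<close> is
  a common invariant dense domain of the (in general unbounded) operators. \<open>symbols\<close> is the class of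
  functions to which the quantization applies; as usual in semiclassical analysis a symbol is a
  complex function depending on the deformation parameter.\<close>

record ('x, 'd::finite, 'h) quantum_data = "('x, 'd) ether_data" +
  hbars :: "real set"
  meas :: "real \<Rightarrow> 'x measure"
  mu :: "real \<Rightarrow> real"
  core :: "real \<Rightarrow> 'h set"
  Sop :: "real \<Rightarrow> 'x \<Rightarrow> 'h \<Rightarrow> 'h"
  qether :: "real \<Rightarrow> ('x, 'd) chart \<Rightarrow> 'x \<Rightarrow> 'x \<Rightarrow> complex^'d"
  symbols :: "(real \<Rightarrow> 'x \<Rightarrow> complex) set"

text \<open>The integral defining the operator is understood weakly on the core; here \<open>CARD('d) = 2n\<close>
  (the dimension is even because the symplectic form is nondegenerate).\<close>

definition weak_quantization ::
  "('x, 'd::finite, 'h::complex_hilbert_space, 'm) quantum_data_scheme \<Rightarrow> real \<Rightarrow> ('x \<Rightarrow> complex)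
     \<Rightarrow> 'h \<Rightarrow> 'h \<Rightarrow> bool" where
  "weak_quantization Q h f \<psi> v \<longleftrightarrow> (\<forall>\<phi>\<in>core Q h.
     integrable (meas Q h) (\<lambda>x. f x * cinner \<phi> (Sop Q h x \<psi>))
     \<and> cinner \<phi> v = complex_of_real (1 / (2 * pi * h) ^ (CARD('d) div 2))
                      * (\<integral>x. f x * cinner \<phi> (Sop Q h x \<psi>) \<partial>meas Q h))"

definition quantize ::
  "('x, 'd::finite, 'h::complex_hilbert_space, 'm) quantum_data_scheme \<Rightarrow> real \<Rightarrow> ('x \<Rightarrow> complex)
     \<Rightarrow> 'h \<Rightarrow> 'h" where
  "quantize Q h f \<psi> = (THE v. weak_quantization Q h f \<psi> v)"

definition quantum_evolution ::
  "('x, 'd::finite, 'h::complex_hilbert_space, 'm) quantum_data_scheme \<Rightarrow> real \<Rightarrow> (real \<Rightarrow> 'x) \<Rightarrow> real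
     \<Rightarrow> (real \<Rightarrow> 'h \<Rightarrow> 'h) \<Rightarrow> bool" where
  "quantum_evolution Q h \<gamma> T U \<longleftrightarrow>
     (\<forall>t\<in>closed_segment 0 T. unitary_operator (U t) \<and> U t ` core Q h = core Q h)
     \<and> U 0 = id
     \<and> (\<forall>\<psi>\<in>core Q h. \<forall>t\<in>closed_segment 0 T. \<forall>c\<in>atlas Q. \<gamma> t \<in> cdom c \<longrightarrow>
          (\<exists>V. ((\<lambda>\<tau>. U \<tau> \<psi>) has_vector_derivative V) (at t within closed_segment 0 T)
             \<and> (\<i> * complex_of_real h) *\<^sub>C V =
                 (1/2) *\<^sub>R (\<Sum>k\<in>UNIV. velocity c \<gamma> t $ k
                            *\<^sub>R quantize Q h (\<lambda>z. qether Q h c (\<gamma> t) z $ k) (U t \<psi>))))"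

definition quantum_path ::
  "('x, 'd::finite, 'h::complex_hilbert_space, 'm) quantum_data_scheme \<Rightarrow> real \<Rightarrow> (real \<Rightarrow> 'x) \<Rightarrow> real
     \<Rightarrow> 'h \<Rightarrow> 'h" where
  "quantum_path Q h \<gamma> T = (THE W. \<exists>U. quantum_evolution Q h \<gamma> T U \<and> U T = W)"

definition quantum_pullback ::
  "('x, 'd::finite, 'h::complex_hilbert_space, 'm) quantum_data_scheme \<Rightarrow> real \<Rightarrow> (real \<Rightarrow> 'x) \<Rightarrow> real
     \<Rightarrow> ('x \<Rightarrow> complex) \<Rightarrow> 'x \<Rightarrow> complex" where
  "quantum_pullback Q h \<gamma> T f =
     (THE g. g \<in> (\<lambda>F. F h) ` symbols Q \<and>
        (\<forall>\<psi>\<in>core Q h. quantize Q h g \<psi> =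
           inv (quantum_path Q h \<gamma> T) (quantize Q h f (quantum_path Q h \<gamma> T \<psi>))))"

text \<open>\<open>F = O(h\<^sup>2)\<close> for a family of functions, in the topology of smooth functions: uniformly on
  compact sets together with all derivatives.\<close>

definition O_hbar2 ::
  "('x, 'd::finite, 'h::complex_hilbert_space, 'm) quantum_data_scheme \<Rightarrow> (real \<Rightarrow> 'x \<Rightarrow> complex)
     \<Rightarrow> bool" where
  "O_hbar2 Q F \<longleftrightarrow>
     (\<forall>\<^sub>F h in at 0 within hbars Q. smooth_fun (atlas Q) (F h)) \<and>
     (\<forall>c\<in>atlas Q. \<forall>K. compact K \<and> K \<subseteq> crange c \<longrightarrow> (\<forall>js. \<exists>B.
        \<forall>\<^sub>F h in at 0 within hbars Q. \<forall>u\<in>K.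
          norm (dir_derivs (map (\<lambda>j. axis j 1) js) (F h \<circ> cinv c) u) \<le> B * h\<^sup>2))"

locale ether_quantization = ether_manifold Q
  for Q :: "('x::{second_countable_topology, t2_space}, 'd::finite, 'h::complex_hilbert_space, 'm)
              quantum_data_scheme" +
  assumes hbars_pos: "hbars Q \<subseteq> {0<..}"
    and hbars_limit: "0 islimpt hbars Q"
    and sets_meas: "h \<in> hbars Q \<Longrightarrow> sets (meas Q h) = sets borel"
    and core_dense: "h \<in> hbars Q \<Longrightarrow> dense_subspace (core Q h)"

    and symbols_smooth: "\<lbrakk>f \<in> symbols Q; h \<in> hbars Q\<rbrakk> \<Longrightarrow> smooth_fun (atlas Q) (f h)"
    and symbols_add: "\<lbrakk>f \<in> symbols Q; g \<in> symbols Q\<rbrakk> \<Longrightarrow> (\<lambda>h x. f h x + g h x) \<in> symbols Q"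
    and symbols_scale: "f \<in> symbols Q \<Longrightarrow> (\<lambda>h x. a * f h x) \<in> symbols Q"
    and symbols_one: "(\<lambda>h x. 1) \<in> symbols Q"

    \<comment> \<open>a faithful unital representation of the product \<open>f * g\<close>, so that \<open>f * g\<close> and the
        pullbacks along quantum paths are determined by their operators\<close>
    and quantizable: "\<lbrakk>f \<in> symbols Q; h \<in> hbars Q; \<psi> \<in> core Q h\<rbrakk> \<Longrightarrow>
      \<exists>v\<in>core Q h. weak_quantization Q h (f h) \<psi> v"
    and quantize_one: "\<lbrakk>h \<in> hbars Q; \<psi> \<in> core Q h\<rbrakk> \<Longrightarrow> quantize Q h (\<lambda>x. 1) \<psi> = \<psi>"
    and quantize_inj: "\<lbrakk>f \<in> symbols Q; g \<in> symbols Q; h \<in> hbars Q;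
        \<And>\<psi>. \<psi> \<in> core Q h \<Longrightarrow> quantize Q h (f h) \<psi> = quantize Q h (g h) \<psi>\<rbrakk> \<Longrightarrow> f h = g h"
    and star_product: "\<lbrakk>f \<in> symbols Q; g \<in> symbols Q\<rbrakk> \<Longrightarrow>
      \<exists>p\<in>symbols Q. \<forall>h\<in>hbars Q. \<forall>\<psi>\<in>core Q h.
        quantize Q h (p h) \<psi> = quantize Q h (f h) (quantize Q h (g h) \<psi>)"

    and qether_form: "h \<in> hbars Q \<Longrightarrow> function_valued_form (atlas Q) (qether Q h)"
    and qether_symbol: "\<lbrakk>c \<in> atlas Q; x \<in> cdom c\<rbrakk> \<Longrightarrow> (\<lambda>h z. qether Q h c x z $ k) \<in> symbols Q"
    and qether_flat: "\<lbrakk>h \<in> hbars Q; c \<in> atlas Q; x \<in> cdom c; \<psi> \<in> core Q h\<rbrakk> \<Longrightarrow>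
      (\<forall>k. (\<lambda>u. quantize Q h (\<lambda>z. qether Q h c (cinv c u) z $ k) \<psi>) differentiable (at (cmap c x)))
      \<and> pderiv_chart c j (\<lambda>x. quantize Q h (\<lambda>z. qether Q h c x z $ k) \<psi>) x
        - pderiv_chart c k (\<lambda>x. quantize Q h (\<lambda>z. qether Q h c x z $ j) \<psi>) x
        + (\<i> / complex_of_real h) *\<^sub>C
           (quantize Q h (\<lambda>z. qether Q h c x z $ j) (quantize Q h (\<lambda>z. qether Q h c x z $ k) \<psi>)
            - quantize Q h (\<lambda>z. qether Q h c x z $ k) (quantize Q h (\<lambda>z. qether Q h c x z $ j) \<psi>))
        = 0"
    and qether_symmetric: "\<lbrakk>h \<in> hbars Q; c \<in> atlas Q; x \<in> cdom c; \<phi> \<in> core Q h; \<psi> \<in> core Q h\<rbrakk> \<Longrightarrow>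
      cinner \<phi> (quantize Q h (\<lambda>z. qether Q h c x z $ k) \<psi>)
        = cinner (quantize Q h (\<lambda>z. qether Q h c x z $ k) \<phi>) \<psi>"
    and qether_classical: "\<lbrakk>c \<in> atlas Q; x \<in> cdom c\<rbrakk> \<Longrightarrow>
      O_hbar2 Q (\<lambda>h z. qether Q h c x z $ k - complex_of_real (ether Q c x z $ k))"

    and S_linear: "h \<in> hbars Q \<Longrightarrow> complex_linear (Sop Q h x)"
    and S_core: "\<lbrakk>h \<in> hbars Q; \<psi> \<in> core Q h\<rbrakk> \<Longrightarrow> Sop Q h x \<psi> \<in> core Q h"
    and S_selfadjoint: "h \<in> hbars Q \<Longrightarrow> cinner \<phi> (Sop Q h x \<psi>) = cinner (Sop Q h x \<phi>) \<psi>"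
    and S_square: "h \<in> hbars Q \<Longrightarrow> Sop Q h x (Sop Q h x \<psi>) = complex_of_real ((mu Q h)\<^sup>2) *\<^sub>C \<psi>"
    and S_eq: "\<lbrakk>h \<in> hbars Q; c \<in> atlas Q; x \<in> cdom c; \<psi> \<in> core Q h\<rbrakk> \<Longrightarrow>
      (\<lambda>u. Sop Q h (cinv c u) \<psi>) differentiable (at (cmap c x))
      \<and> (\<i> * complex_of_real h) *\<^sub>C pderiv_chart c k (\<lambda>x. Sop Q h x \<psi>) x
        = quantize Q h (\<lambda>z. qether Q h c x z $ k) (Sop Q h x \<psi>)"

    \<comment> \<open>the symplectic and the quantum path are defined for every path, and so is the
        action on symbols of the latter\<close>
    and symplectic_path_exists: "smooth_path (atlas Q) \<gamma> T \<Longrightarrow>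
      \<exists>Y. translation_trajectory Q \<gamma> T Y \<and> Y 0 = z"
    and symplectic_path_smooth: "smooth_path (atlas Q) \<gamma> T \<Longrightarrow>
      smooth_map (atlas Q) (symplectic_path Q \<gamma> T)"
    and quantum_path_exists: "\<lbrakk>h \<in> hbars Q; smooth_path (atlas Q) \<gamma> T\<rbrakk> \<Longrightarrow>
      \<exists>U. quantum_evolution Q h \<gamma> T U"
    and quantum_pullback_exists: "\<lbrakk>smooth_path (atlas Q) \<gamma> T; f \<in> symbols Q\<rbrakk> \<Longrightarrow>
      \<exists>g\<in>symbols Q. \<forall>h\<in>hbars Q. \<forall>\<psi>\<in>core Q h. quantize Q h (g h) \<psi> =
        inv (quantum_path Q h \<gamma> T) (quantize Q h (f h) (quantum_path Q h \<gamma> T \<psi>))"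
    and quantum_pullback_expansion: "\<lbrakk>smooth_path (atlas Q) \<gamma> T; f \<in> symbols Q\<rbrakk> \<Longrightarrow>
      \<exists>r. O_hbar2 Q r \<and> (\<forall>h\<in>hbars Q. \<forall>z. quantum_pullback Q h \<gamma> T (f h) z =
        f h (symplectic_path Q \<gamma> T z) + r h (symplectic_path Q \<gamma> T z))"


section \<open>Translocations\<close>

definition translocation ::
  "('x, 'd::finite, 'h::complex_hilbert_space, 'm) quantum_data_scheme \<Rightarrow> ('x \<Rightarrow> real)
     \<Rightarrow> (real \<Rightarrow> 'x \<Rightarrow> 'x) \<Rightarrow> real \<Rightarrow> 'x \<Rightarrow> real \<Rightarrow> 'h \<Rightarrow> 'h" where
  "translocation Q H X h y t \<psi> =
     exp (- (\<i> / complex_of_real h) * complex_of_real (H y * t))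
       *\<^sub>C quantum_path Q h (\<lambda>\<tau>. X \<tau> y) t \<psi>"

definition quantum_translocated_ham ::
  "('x, 'd::finite, 'h::complex_hilbert_space, 'm) quantum_data_scheme \<Rightarrow> ('x \<Rightarrow> real)
     \<Rightarrow> (real \<Rightarrow> 'x \<Rightarrow> 'x) \<Rightarrow> real \<Rightarrow> 'x \<Rightarrow> real \<Rightarrow> 'x \<Rightarrow> complex" where
  "quantum_translocated_ham Q H X h y t z =
     quantum_pullback Q h (\<lambda>\<tau>. X \<tau> y) t
       (\<lambda>w. complex_of_real (H w) - 1/2 * contract_velocity Q (qether Q h) (\<lambda>\<tau>. X \<tau> y) t w) z
     - complex_of_real (H y)"

definition classical_translocated_ham ::
  "('x::topological_space, 'd::finite, 'm) ether_data_scheme \<Rightarrow> ('x \<Rightarrow> real) \<Rightarrow> (real \<Rightarrow> 'x \<Rightarrow> 'x)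
     \<Rightarrow> 'x \<Rightarrow> real \<Rightarrow> 'x \<Rightarrow> real" where
  "classical_translocated_ham M H X y t z =
     (let w = symplectic_path M (\<lambda>\<tau>. X \<tau> y) t z
      in H w - 1/2 * contract_velocity M (ether M) (\<lambda>\<tau>. X \<tau> y) t w) - H y"

text \<open>The operator \<open>-i h \<partial>/\<partial>t + K(t)\<close> on vector functions of time.\<close>

definition time_operator ::
  "real \<Rightarrow> (real \<Rightarrow> 'h \<Rightarrow> 'h) \<Rightarrow> (real \<Rightarrow> 'h::complex_hilbert_space) \<Rightarrow> real \<Rightarrow> 'h" where
  "time_operator h K \<psi> t = (- \<i> * complex_of_real h) *\<^sub>C vector_derivative \<psi> (at t) + K t (\<psi> t)"

end

theory Submission
  imports Defs
begin

text \<open>The statement has two independent halves.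

  The permutation formula is Leibniz' rule. The translocation is a phase times the quantum path
  \<open>W t\<close>, and \<open>W t\<close> solves a Schroedinger equation whose generator is \<open>1/2\<close> times the operator of the
  quantum intrinsic Hamiltonian contracted with the velocity. Applying
  \<open>- i h \<partial>/\<partial>t\<close> to \<open>exp (- i H(y) t / h) W t (\<psi> t)\<close> therefore produces, up to the phase, the vector
  \<open>W t (- i h \<psi>')\<close>, minus the generator and minus the constant \<open>H(y)\<close>, both applied to \<open>W t (\<psi> t)\<close>.
  The last two terms together with the operator of \<open>H\<close> stand to the left of \<open>W t\<close>;
  moving them to its right is conjugation by \<open>W t\<close>, which by definition is the quantum pullback of the
  symbol. Two analytic points need care.

  First, the quantum path is defined separately for every end point, as the value of some evolution at
  that point; to differentiate in the end point one has to know that these values fit together. Since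
  the generator is symmetric on the core, the distance of two evolutions of the same vector is
  constant, so evolutions are unique (\<open>quantum_evolution_unique\<close>) and restrict to one another, and all
  end points are served by one evolution (\<open>quantum_path_evolution\<close>). At time \<open>0\<close> this yields only two
  one-sided derivatives, which agree because both are given by the equation.

  Second, \<open>W t\<close> is differentiable in \<open>t\<close> only on vectors of the core, whereas the derivative
  of \<open>\<psi>\<close> may lie outside of it. Leibniz' rule survives because the operators are isometries: they are
  strongly continuous on the whole space, and only the vector \<open>\<psi> t\<close> itself has to be in the core
  (\<open>unitary_family_product_rule\<close>).

  For the classical limit, the expansion of the quantum pullback writes the difference of the two
  translocated Hamiltonians as a family of functions composed with the symplectic path; the family is
  \<open>O(h\<^sup>2)\<close> because the quantum intrinsic Hamiltonian is \<open>O(h\<^sup>2)\<close>-close to the Ether Hamiltonian. What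
  remains is that \<open>O(h\<^sup>2)\<close>, in the sense of all derivatives on compact sets, is stable under
  composition with a smooth map (\<open>O_hbar2_compose\<close>). This follows from a form of the chain rule
  for iterated derivatives in which the coefficients depend on the inner map only, hence not on \<open>h\<close>
  (\<open>dir_derivs_chain\<close>).\<close>

section \<open>Complex Hilbert spaces\<close>

lemma scaleC_scaleR_commute:
  fixes u :: "'h::complex_hilbert_space"
  shows "a *\<^sub>C (r *\<^sub>R u) = r *\<^sub>R (a *\<^sub>C u)"
  by (simp add: scaleR_scaleC scaleC_scaleC mult.commute)

lemma cinner_scaleC_left:
  fixes u :: "'h::complex_hilbert_space"
  shows "cinner (a *\<^sub>C u) v = cnj a * cinner u v"
  by (metis cinner_commute cinner_scaleC_right complex_cnj_mult)

lemma norm_scaleC: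
  fixes u :: "'h::complex_hilbert_space"
  shows "norm (a *\<^sub>C u) = cmod a * norm u"
proof -
  have "inner (a *\<^sub>C u) (a *\<^sub>C u) = Re ((a * cnj a) * cinner u u)"
    by (simp add: Re_cinner [symmetric] cinner_scaleC_left cinner_scaleC_right algebra_simps)
  also have "\<dots> = (cmod a)\<^sup>2 * inner u u"
    by (simp add: complex_norm_square [symmetric] Re_cinner [symmetric] del: of_real_power)
  finally show ?thesis
    by (simp add: norm_eq_sqrt_inner real_sqrt_mult)
qed

lemma bounded_bilinear_scaleC:
  "bounded_bilinear (scaleC :: complex \<Rightarrow> 'h \<Rightarrow> 'h::complex_hilbert_space)"
proof
  fix a b :: complex and u v :: 'h and r :: real
  show "(a + b) *\<^sub>C u = a *\<^sub>C u + b *\<^sub>C u" by (rule scaleC_add_left)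
  show "a *\<^sub>C (u + v) = a *\<^sub>C u + a *\<^sub>C v" by (rule scaleC_add_right)
  show "(r *\<^sub>R a) *\<^sub>C u = r *\<^sub>R (a *\<^sub>C u)"
    by (simp add: scaleR_scaleC scaleC_scaleC scaleR_conv_of_real)
  show "a *\<^sub>C (r *\<^sub>R u) = r *\<^sub>R (a *\<^sub>C u)" by (rule scaleC_scaleR_commute)
  show "\<exists>K. \<forall>a u. norm (a *\<^sub>C (u::'h)) \<le> norm a * norm u * K"
    by (rule exI [of _ 1]) (simp add: norm_scaleC)
qed

interpretation scaleC: bounded_bilinear "scaleC :: complex \<Rightarrow> 'h \<Rightarrow> 'h::complex_hilbert_space"
  by (rule bounded_bilinear_scaleC)

lemma scaleC_one: "1 *\<^sub>C u = (u :: 'h::complex_hilbert_space)"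
  using scaleR_scaleC [of 1 u] by simp

lemma cinner_diff_right:
  fixes u :: "'h::complex_hilbert_space"
  shows "cinner u (v - w) = cinner u v - cinner u w"
  using cinner_add_right [of u "v - w" w] by simp

lemma cinner_zero_right: "cinner (u :: 'h::complex_hilbert_space) 0 = 0"
  using cinner_add_right [of u 0 0] by simp

lemma cinner_sum_right:
  fixes u :: "'h::complex_hilbert_space"
  shows "cinner u (\<Sum>k\<in>S. f k) = (\<Sum>k\<in>S. cinner u (f k))"
  by (induction S rule: infinite_finite_induct) (simp_all add: cinner_zero_right cinner_add_right)

text \<open>This makes the weakly defined quantization single-valued: its values are tested against the core only.\<close>

lemma eq_of_cinner_dense:
  fixes v w :: "'h::complex_hilbert_space"
  assumes "dense_subspace D" and "\<And>\<phi>. \<phi> \<in> D \<Longrightarrow> cinner \<phi> v = cinner \<phi> w"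
  shows "v = w"
proof -
  have "inner \<phi> (v - w) = 0" if "\<phi> \<in> D" for \<phi>
    using assms(2) [OF that] by (simp add: Re_cinner [symmetric] cinner_diff_right)
  moreover have "closed {\<phi>. inner \<phi> (v - w) = 0}"
    by (intro closed_Collect_eq continuous_intros)
  ultimately have "closure D \<subseteq> {\<phi>. inner \<phi> (v - w) = 0}"
    by (intro closure_minimal) auto
  moreover have "closure D = UNIV"
    using assms(1) by (simp add: dense_subspace_def)
  ultimately have "inner (v - w) (v - w) = 0"
    by blast
  then show ?thesis by simp
qed

lemma unitary_operator_norm: "unitary_operator U \<Longrightarrow> norm (U u) = norm u"
  by (metis Re_cinner norm_eq_sqrt_inner unitary_operator_def)

lemma unitary_operator_add: "unitary_operator U \<Longrightarrow> U (u + v) = U u + U v"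
  and unitary_operator_scaleC: "unitary_operator U \<Longrightarrow> U (a *\<^sub>C u) = a *\<^sub>C U u"
  by (simp_all add: unitary_operator_def complex_linear_def)

lemma unitary_operator_diff: "unitary_operator U \<Longrightarrow> U (u - v) = U u - U v"
  using unitary_operator_add [of U "u - v" v] by simp

lemma unitary_operator_scaleR: "unitary_operator U \<Longrightarrow> U (r *\<^sub>R u) = r *\<^sub>R U u"
  by (simp add: scaleR_scaleC unitary_operator_scaleC)

lemma unitary_operator_inv:
  assumes "unitary_operator U"
  shows "U (inv U u) = u" 
  using assms by (simp add: unitary_operator_def surj_f_inv_f)

lemma unitary_operator_eq_of_dense:
  assumes U: "unitary_operator U" and V: "unitary_operator V" and D: "closure D = UNIV"
    and eq: "\<And>\<phi>. \<phi> \<in> D \<Longrightarrow> U \<phi> = V \<phi>"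
  shows "U = V"
proof
  fix u
  have "bounded_linear W" if "unitary_operator W" for W :: "'a \<Rightarrow> 'a"
    using that by (intro bounded_linear_intro [where K = 1])
      (simp_all add: unitary_operator_add unitary_operator_scaleR unitary_operator_norm)
  then have "closed {u. U u = V u}"
    using U V by (intro closed_Collect_eq) (auto intro: linear_continuous_on)
  then have "closure D \<subseteq> {u. U u = V u}"
    using eq by (intro closure_minimal) auto
  then show "U u = V u" using D by auto
qed

section \<open>Strongly differentiable families of unitary operators\<close>

text \<open>An \<open>\<epsilon>/3\<close> argument: the operators of the family are isometries, hence equicontinuous, so continuity of
  the orbits passes from a dense set to its closure.\<close>

lemma unitary_family_strongly_continuous:
  fixes W :: "real \<Rightarrow> 'h::complex_hilbert_space \<Rightarrow> 'h"
  assumes unit: "\<forall>\<^sub>F \<tau> in at t. unitary_operator (W \<tau>)" "unitary_operator (W t)"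
    and D: "closure D = UNIV"
    and cont: "\<And>\<phi>. \<phi> \<in> D \<Longrightarrow> ((\<lambda>\<tau>. W \<tau> \<phi>) \<longlongrightarrow> W t \<phi>) (at t)"
  shows "((\<lambda>\<tau>. W \<tau> u) \<longlongrightarrow> W t u) (at t)"
proof (rule tendstoI)
  fix e :: real assume "e > 0"
  then obtain \<phi> where \<phi>: "\<phi> \<in> D" "dist \<phi> u < e / 3"
    using D closure_approachable [of u D] by (metis UNIV_I divide_pos_pos zero_less_numeral)
  have "\<forall>\<^sub>F \<tau> in at t. dist (W \<tau> \<phi>) (W t \<phi>) < e / 3"
    using cont [OF \<phi>(1)] \<open>e > 0\<close> by (auto dest: tendstoD [where e = "e / 3"])
  with unit(1) show "\<forall>\<^sub>F \<tau> in at t. dist (W \<tau> u) (W t u) < e"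
  proof eventually_elim
    case (elim \<tau>)
    have "dist (W s u) (W s \<phi>) < e / 3" if "unitary_operator (W s)" for s
      using \<phi>(2) that by (metis dist_commute dist_norm unitary_operator_diff unitary_operator_norm)
    from this [OF elim(1)] this [OF unit(2)] elim(2) show ?case
      using dist_triangle [of "W \<tau> u" "W t u" "W \<tau> \<phi>"] dist_triangle [of "W \<tau> \<phi>" "W t u" "W t \<phi>"]
      by (simp add: dist_commute)
  qed
qed

text \<open>The operators are differentiable only in the strong sense and only along \<open>\<psi> t\<close>; the derivative \<open>v\<close>
  need not be a vector along which the family is differentiable. The difference quotient at \<open>t\<close>
  splits into three parts: the remainder of \<open>\<psi>\<close>, which an isometry does not enlarge; the difference
  of the operators on \<open>v\<close>, where strong continuity suffices; and the remainder along the fixed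
  vector \<open>\<psi> t\<close>.\<close>

lemma unitary_family_product_rule:
  fixes W :: "real \<Rightarrow> 'h::complex_hilbert_space \<Rightarrow> 'h"
  assumes unit: "\<forall>\<^sub>F \<tau> in at t. unitary_operator (W \<tau>)" "unitary_operator (W t)"
    and D: "closure D = UNIV"
    and cont: "\<And>\<phi>. \<phi> \<in> D \<Longrightarrow> ((\<lambda>\<tau>. W \<tau> \<phi>) \<longlongrightarrow> W t \<phi>) (at t)"
    and \<psi>: "(\<psi> has_vector_derivative v) (at t)"
    and W: "((\<lambda>\<tau>. W \<tau> (\<psi> t)) has_vector_derivative w) (at t)"
  shows "((\<lambda>\<tau>. W \<tau> (\<psi> \<tau>)) has_vector_derivative (W t v + w)) (at t)"
proof -
  define R\<psi> where "R\<psi> y = (1 / norm (y - t)) *\<^sub>R (\<psi> y - (\<psi> t + (y - t) *\<^sub>R v))" for y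
  define RW where "RW y = (1 / norm (y - t)) *\<^sub>R (W y (\<psi> t) - (W t (\<psi> t) + (y - t) *\<^sub>R w))" for y
  define Rv where "Rv y = ((y - t) / norm (y - t)) *\<^sub>R (W y v - W t v)" for y
  have "(R\<psi> \<longlongrightarrow> 0) (at t)" "(RW \<longlongrightarrow> 0) (at t)"
    using \<psi> W by (simp_all add: has_vector_derivative_def has_derivative_within R\<psi>_def [abs_def]
        RW_def [abs_def])
  then have "((\<lambda>y. norm (R\<psi> y)) \<longlongrightarrow> 0) (at t)"
    by (simp add: tendsto_norm_zero)
  then have first: "((\<lambda>y. W y (R\<psi> y)) \<longlongrightarrow> 0) (at t)"
    by (rule tendsto_0_le [where K = 1]) 
      (use unit(1) in \<open>eventually_elim, simp add: unitary_operator_norm\<close>)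
  have "((\<lambda>\<tau>. W \<tau> v - W t v) \<longlongrightarrow> 0) (at t)"
    using unitary_family_strongly_continuous [OF unit D cont] LIM_zero by blast
  then have second: "(Rv \<longlongrightarrow> 0) (at t)"
    by (rule tendsto_0_le [where K = 1]) (auto simp: Rv_def)
  have "((\<lambda>y. W y (R\<psi> y) + Rv y + RW y) \<longlongrightarrow> 0 + 0 + 0) (at t)"
    by (intro tendsto_add first second \<open>(RW \<longlongrightarrow> 0) (at t)\<close>)
  moreover have "\<forall>\<^sub>F y in at t. W y (R\<psi> y) + Rv y + RW y
      = (1 / norm (y - t)) *\<^sub>R (W y (\<psi> y) - (W t (\<psi> t) + (y - t) *\<^sub>R (W t v + w)))"
    using unit(1)
    by eventually_elim
      (simp add: R\<psi>_def RW_def Rv_def unitary_operator_add unitary_operator_diff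
        unitary_operator_scaleR algebra_simps diff_divide_distrib)
  ultimately have "((\<lambda>y. (1 / norm (y - t)) *\<^sub>R
      (W y (\<psi> y) - (W t (\<psi> t) + (y - t) *\<^sub>R (W t v + w)))) \<longlongrightarrow> 0 + 0 + 0) (at t)"
    by (rule Lim_transform_eventually)
  then show ?thesis
    by (simp add: has_vector_derivative_def has_derivative_within bounded_linear_scaleR_left)
qed

section \<open>Iterated directional derivatives\<close>

lemma dir_deriv_eq: "(f has_derivative f') (at u) \<Longrightarrow> dir_deriv v f u = f' v"
  by (simp add: dir_deriv_def frechet_derivative_at [symmetric])

lemma has_derivative_dir_deriv:
  "f differentiable (at u) \<Longrightarrow> (f has_derivative (\<lambda>v. dir_deriv v f u)) (at u)"
  by (simp add: dir_deriv_def [abs_def] frechet_derivative_works)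

text \<open>Both derivatives are the same choice from the same set of linear maps, also at points where
  that set is empty.\<close>

lemma dir_deriv_cong:
  assumes "open A" "u \<in> A" "\<And>x. x \<in> A \<Longrightarrow> f x = g x"
  shows "dir_deriv v f u = dir_deriv v g u"
proof -
  have "(f has_derivative D) (at u) \<longleftrightarrow> (g has_derivative D) (at u)" for D
    using has_derivative_transform_within_open [OF _ assms(1,2), of _ D UNIV] assms(3) by metis
  then show ?thesis by (simp add: dir_deriv_def frechet_derivative_def)
qed

lemma dir_derivs_cong:
  assumes "open A" "u \<in> A" "\<And>x. x \<in> A \<Longrightarrow> f x = g x"
  shows "dir_derivs vs f u = dir_derivs vs g u"
  using assms(2)
proof (induction vs arbitrary: u)
  case Nil
  then show ?case by (simp add: assms(3))
next
  case (Cons v vs)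
  show ?case
    by (simp, rule dir_deriv_cong [OF assms(1) Cons.prems]) (rule Cons.IH)
qed

lemma differentiable_cong_open:
  assumes "open A" "u \<in> A" "\<And>x. x \<in> A \<Longrightarrow> f x = g x" "f differentiable (at u)"
  shows "g differentiable (at u)"
  using assms has_derivative_transform_within_open unfolding differentiable_def by blast

lemma smooth_on_cong:
  assumes "open A" "\<And>x. x \<in> A \<Longrightarrow> f x = g x" "smooth_on A f"
  shows "smooth_on A g"
  unfolding smooth_on_def
proof (intro allI ballI)
  fix vs u assume u: "u \<in> A"
  have eq: "dir_derivs vs f x = dir_derivs vs g x" if "x \<in> A" for x
    by (rule dir_derivs_cong [OF assms(1) that assms(2)])
  have "dir_derivs vs f differentiable (at u)"
    using assms(3) u by (simp add: smooth_on_def)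
  then show "dir_derivs vs g differentiable (at u)"
    by (rule differentiable_cong_open [OF assms(1) u, rotated]) (rule eq)
qed

lemma dir_derivs_append: "dir_derivs (vs @ ws) f = dir_derivs vs (dir_derivs ws f)"
  by (induction vs) auto

lemma smooth_on_differentiable: "smooth_on A f \<Longrightarrow> u \<in> A \<Longrightarrow> f differentiable (at u)"
  using dir_derivs.simps(1) unfolding smooth_on_def by metis

lemma smooth_on_dir_derivs: "smooth_on A f \<Longrightarrow> smooth_on A (dir_derivs vs f)"
  by (simp add: smooth_on_def dir_derivs_append [symmetric])

lemma smooth_on_dir_deriv: "smooth_on A f \<Longrightarrow> smooth_on A (dir_deriv v f)"
  using smooth_on_dir_derivs [of A f "[v]"] by simp

lemma smooth_on_continuous: "smooth_on A f \<Longrightarrow> continuous_on A f"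
  using smooth_on_differentiable
  by (metis continuous_at_imp_continuous_on differentiable_imp_continuous_within)

text \<open>To prove smoothness it is enough to exhibit a formula for each iterated derivative whose right-hand
  side is differentiable.\<close>

lemma smooth_onI_dir_derivs:
  assumes "open A" "\<And>vs. \<exists>g. (\<forall>u\<in>A. dir_derivs vs f u = g u) \<and> (\<forall>u\<in>A. g differentiable (at u))"
  shows "smooth_on A f"
  unfolding smooth_on_def
proof (intro allI ballI)
  fix vs u assume u: "u \<in> A"
  obtain g where g: "\<And>x. x \<in> A \<Longrightarrow> g x = dir_derivs vs f x" "\<And>x. x \<in> A \<Longrightarrow> g differentiable (at x)"
    using assms(2) [of vs] by metis
  show "dir_derivs vs f differentiable (at u)"
    by (rule differentiable_cong_open [OF assms(1) u g(1) g(2) [OF u]])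
qed

lemma dir_derivs_linear:
  assumes "open A" "smooth_on A f" "bounded_linear L" "u \<in> A"
  shows "dir_derivs vs (\<lambda>x. L (f x)) u = L (dir_derivs vs f u)"
  using assms(4)
proof (induction vs arbitrary: u)
  case (Cons v vs)
  have "dir_deriv v (dir_derivs vs (\<lambda>x. L (f x))) u = dir_deriv v (\<lambda>x. L (dir_derivs vs f x)) u"
    by (rule dir_deriv_cong [OF assms(1) Cons.prems]) (rule Cons.IH)
  also have "\<dots> = L (dir_deriv v (dir_derivs vs f) u)"
    by (rule dir_deriv_eq [OF bounded_linear.has_derivative [OF assms(3)
          has_derivative_dir_deriv [OF smooth_on_differentiable
            [OF smooth_on_dir_derivs [OF assms(2)] Cons.prems]]]])
  finally show ?case by simp
qed simp

lemma smooth_on_linear: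
  assumes "open A" "smooth_on A f" "bounded_linear L"
  shows "smooth_on A (\<lambda>x. L (f x))"
proof (rule smooth_onI_dir_derivs [OF assms(1)])
  fix vs
  have "(\<lambda>u. L (dir_derivs vs f u)) differentiable (at u)" if "u \<in> A" for u
    by (rule differentiable_compose [OF bounded_linear_imp_differentiable [OF assms(3)]
          smooth_on_differentiable [OF smooth_on_dir_derivs [OF assms(2)] that]])
  then show "\<exists>g. (\<forall>u\<in>A. dir_derivs vs (\<lambda>x. L (f x)) u = g u) \<and> (\<forall>u\<in>A. g differentiable (at u))"
    by (intro exI [of _ "\<lambda>u. L (dir_derivs vs f u)"] conjI ballI dir_derivs_linear [OF assms])
qed

lemma smooth_on_const: "smooth_on A (\<lambda>u. c)"
proof -
  have "\<exists>d. dir_derivs vs (\<lambda>u. c) = (\<lambda>u. d)" for vs :: "'a list"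
  proof (induction vs)
    case (Cons v vs)
    then obtain d where "dir_derivs vs (\<lambda>u. c) = (\<lambda>u. d)" by blast
    then show ?case by (auto simp: dir_deriv_eq [OF has_derivative_const])
  qed auto
  then show ?thesis
    unfolding smooth_on_def by (metis differentiable_const)
qed

lemma dir_derivs_add:
  assumes "open A" "smooth_on A f" "smooth_on A g" "u \<in> A"
  shows "dir_derivs vs (\<lambda>x. f x + g x) u = dir_derivs vs f u + dir_derivs vs g u"
  using assms(4)
proof (induction vs arbitrary: u)
  case (Cons v vs)
  have "dir_deriv v (dir_derivs vs (\<lambda>x. f x + g x)) u
      = dir_deriv v (\<lambda>x. dir_derivs vs f x + dir_derivs vs g x) u"
    by (rule dir_deriv_cong [OF assms(1) Cons.prems]) (rule Cons.IH)
  also have "\<dots> = dir_deriv v (dir_derivs vs f) u + dir_deriv v (dir_derivs vs g) u"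
    by (rule dir_deriv_eq [OF has_derivative_add [OF has_derivative_dir_deriv
          has_derivative_dir_deriv]])
      (rule smooth_on_differentiable [OF smooth_on_dir_derivs Cons.prems], rule assms)+
  finally show ?case by simp
qed simp

lemma smooth_on_add:
  assumes "open A" "smooth_on A f" "smooth_on A g"
  shows "smooth_on A (\<lambda>x. f x + g x)"
proof (rule smooth_onI_dir_derivs [OF assms(1)])
  fix vs
  have "(\<lambda>u. dir_derivs vs f u + dir_derivs vs g u) differentiable (at u)" if "u \<in> A" for u
    by (intro differentiable_add smooth_on_differentiable [OF smooth_on_dir_derivs that] assms(2,3))
  then show "\<exists>k. (\<forall>u\<in>A. dir_derivs vs (\<lambda>x. f x + g x) u = k u) \<and> (\<forall>u\<in>A. k differentiable (at u))"
    by (intro exI [of _ "\<lambda>u. dir_derivs vs f u + dir_derivs vs g u"] conjI ballI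
        dir_derivs_add [OF assms])
qed

lemma has_derivative_sum_list:
  assumes "\<And>i. i \<in> set L \<Longrightarrow> (f i has_derivative f' i) F"
  shows "((\<lambda>u. \<Sum>i\<leftarrow>L. f i u) has_derivative (\<lambda>v. \<Sum>i\<leftarrow>L. f' i v)) F"
  using assms by (induction L) (auto intro: has_derivative_add)

lemma differentiable_sum_list:
  assumes "\<And>i. i \<in> set L \<Longrightarrow> f i differentiable (at u)"
  shows "(\<lambda>u. \<Sum>i\<leftarrow>L. f i u) differentiable (at u)"
  using assms by (induction L) auto

lemma sum_list_concat_map:
  "sum_list (map f (concat (map k L))) = (\<Sum>i\<leftarrow>L. sum_list (map f (k i)))"
  for f :: "'a \<Rightarrow> 'b::real_vector"
  by (induction L) auto

text \<open>Which pairs of derivative lists occur is irrelevant for smoothness, so the combinatorics of the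
  Leibniz rule is hidden in a list \<open>L\<close> that grows by the product rule.\<close>

lemma dir_derivs_Leibniz:
  fixes a :: "'a::real_normed_vector \<Rightarrow> real" and b :: "'a \<Rightarrow> 'b::real_normed_vector"
  assumes "open A" "smooth_on A a" "smooth_on A b"
  shows "\<exists>L. \<forall>u\<in>A. dir_derivs vs (\<lambda>x. a x *\<^sub>R b x) u
    = (\<Sum>i\<leftarrow>L. dir_derivs (fst i) a u *\<^sub>R dir_derivs (snd i) b u)"
proof (induction vs)
  case Nil
  show ?case by (rule exI [of _ "[([], [])]"]) simp
next
  case (Cons v vs)
  then obtain L where L: "\<And>u. u \<in> A \<Longrightarrow> dir_derivs vs (\<lambda>x. a x *\<^sub>R b x) u
    = (\<Sum>i\<leftarrow>L. dir_derivs (fst i) a u *\<^sub>R dir_derivs (snd i) b u)"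
    by blast
  define L' where "L' = concat (map (\<lambda>i. [(fst i, v # snd i), (v # fst i, snd i)]) L)"
  have "dir_derivs (v # vs) (\<lambda>x. a x *\<^sub>R b x) u
    = (\<Sum>i\<leftarrow>L'. dir_derivs (fst i) a u *\<^sub>R dir_derivs (snd i) b u)" if u: "u \<in> A" for u
  proof -
    have "dir_deriv v (dir_derivs vs (\<lambda>x. a x *\<^sub>R b x)) u
      = dir_deriv v (\<lambda>u. \<Sum>i\<leftarrow>L. dir_derivs (fst i) a u *\<^sub>R dir_derivs (snd i) b u) u"
      by (rule dir_deriv_cong [OF assms(1) u]) (rule L)
    also have "\<dots> = (\<Sum>i\<leftarrow>L. dir_derivs (fst i) a u *\<^sub>R dir_deriv v (dir_derivs (snd i) b) u
        + dir_deriv v (dir_derivs (fst i) a) u *\<^sub>R dir_derivs (snd i) b u)"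
      by (rule dir_deriv_eq [OF has_derivative_sum_list [OF has_derivative_scaleR
            [OF has_derivative_dir_deriv has_derivative_dir_deriv]]])
        (rule smooth_on_differentiable [OF smooth_on_dir_derivs u], rule assms)+
    finally show ?thesis
      by (simp add: L'_def sum_list_concat_map)
  qed
  then show ?case by blast
qed

lemma smooth_on_scaleR:
  fixes a :: "'a::real_normed_vector \<Rightarrow> real" and b :: "'a \<Rightarrow> 'b::real_normed_vector"
  assumes "open A" "smooth_on A a" "smooth_on A b"
  shows "smooth_on A (\<lambda>x. a x *\<^sub>R b x)"
proof (rule smooth_onI_dir_derivs [OF assms(1)])
  fix vs
  obtain L where L: "\<forall>u\<in>A. dir_derivs vs (\<lambda>x. a x *\<^sub>R b x) u
    = (\<Sum>i\<leftarrow>L. dir_derivs (fst i) a u *\<^sub>R dir_derivs (snd i) b u)"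
    using dir_derivs_Leibniz [OF assms] by blast
  have "(\<lambda>u. \<Sum>i\<leftarrow>L. dir_derivs (fst i) a u *\<^sub>R dir_derivs (snd i) b u) differentiable (at u)"
    if "u \<in> A" for u
    by (intro differentiable_sum_list differentiable_scaleR
        smooth_on_differentiable [OF smooth_on_dir_derivs that] assms(2,3))
  then show "\<exists>k. (\<forall>u\<in>A. dir_derivs vs (\<lambda>x. a x *\<^sub>R b x) u = k u) \<and> (\<forall>u\<in>A. k differentiable (at u))"
    by (intro exI [of _ "\<lambda>u. \<Sum>i\<leftarrow>L. dir_derivs (fst i) a u *\<^sub>R dir_derivs (snd i) b u"] conjI L ballI)
qed

abbreviation axis_derivs ::
  "'n list \<Rightarrow> (real^'n \<Rightarrow> 'b::real_normed_vector) \<Rightarrow> real^'n \<Rightarrow> 'b" where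
  "axis_derivs js \<equiv> dir_derivs (map (\<lambda>j. axis j 1) js)"

lemma dir_deriv_eq_axis_sum:
  fixes g :: "real^'n \<Rightarrow> 'b::real_normed_vector"
  assumes "g differentiable (at p)"
  shows "dir_deriv w g p = (\<Sum>k\<in>UNIV. w $ k *\<^sub>R dir_deriv (axis k 1) g p)"
proof -
  have lin: "bounded_linear (\<lambda>w. dir_deriv w g p)"
    using has_derivative_bounded_linear [OF has_derivative_dir_deriv [OF assms]] .
  have "dir_deriv w g p = dir_deriv (\<Sum>k\<in>UNIV. w $ k *\<^sub>R axis k 1) g p"
    using basis_expansion [of w] by (simp add: scalar_mult_eq_scaleR)
  then show ?thesis
    by (simp only: linear_sum [OF bounded_linear.linear [OF lin]]
        linear_scale [OF bounded_linear.linear [OF lin]])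
qed

text \<open>The chain rule for iterated derivatives (a qualitative form of Faa di Bruno's formula). The quantifier
  order is what matters: the coefficients, the first components in \<open>L\<close>, are chosen before the outer
  function \<open>g\<close>. They are polynomials in derivatives of \<open>\<phi>\<close>, so a bound on the derivatives of a family
  of functions \<open>g\<close> carries over to the composites with a constant that is uniform over the family.\<close>

lemma dir_derivs_chain:
  fixes \<phi> :: "'a::real_normed_vector \<Rightarrow> real^'n"
  assumes A: "open A" "smooth_on A \<phi>" "\<phi> ` A \<subseteq> B"
  shows "\<exists>L. (\<forall>i\<in>set L. smooth_on A (fst i)) \<and>
    (\<forall>g :: real^'n \<Rightarrow> 'b::real_normed_vector. smooth_on B g \<longrightarrow> (\<forall>u\<in>A. dir_derivs vs (\<lambda>x. g (\<phi> x)) u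
      = (\<Sum>i\<leftarrow>L. fst i u *\<^sub>R axis_derivs (snd i) g (\<phi> u))))"
proof (induction vs)
  case Nil
  have "smooth_on A (\<lambda>u. 1 :: real)" by (rule smooth_on_const)
  then show ?case by (intro exI [of _ "[(\<lambda>u. 1, [])]"]) simp
next
  case (Cons v vs)
  let ?D = "\<lambda>ks g. axis_derivs ks (g :: real^'n \<Rightarrow> 'b)"
  obtain L where smooth: "\<And>i. i \<in> set L \<Longrightarrow> smooth_on A (fst i)"
    and L: "\<And>g u. smooth_on B g \<Longrightarrow> u \<in> A \<Longrightarrow> dir_derivs vs (\<lambda>x. g (\<phi> x)) u
      = (\<Sum>i\<leftarrow>L. fst i u *\<^sub>R ?D (snd i) g (\<phi> u))"
    using Cons.IH
    by (elim exE conjE) (rule that, erule (1) bspec, drule spec, drule (1) mp, erule (1) bspec)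
  obtain ns where ns: "set ns = (UNIV :: 'n set)" "distinct ns"
    using finite_distinct_list [OF finite] by blast
  \<comment> \<open>a further derivative either hits the coefficient, or hits \<open>g\<close> and is expanded along the axes\<close>
  define L' where "L' = concat (map (\<lambda>i. (dir_deriv v (fst i), snd i) #
      map (\<lambda>k. (\<lambda>u. fst i u *\<^sub>R (dir_deriv v \<phi> u $ k), k # snd i)) ns) L)"
  have "smooth_on A (fst i)" if i: "i \<in> set L'" for i
  proof -
    have "smooth_on A (\<lambda>u. dir_deriv v \<phi> u $ k)" for k
      by (intro smooth_on_linear [OF A(1) smooth_on_dir_deriv [OF A(2)]] bounded_linear_vec_nth)
    moreover obtain j where "j \<in> set L" "i = (dir_deriv v (fst j), snd j) \<or>
        (\<exists>k. i = (\<lambda>u. fst j u *\<^sub>R (dir_deriv v \<phi> u $ k), k # snd j))"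
      using i unfolding L'_def by auto
    ultimately show ?thesis
      by (elim disjE exE)
        (simp_all only: fst_conv smooth_on_scaleR [OF A(1)] smooth_on_dir_deriv smooth)
  qed
  moreover have "dir_derivs (v # vs) (\<lambda>x. g (\<phi> x)) u = (\<Sum>i\<leftarrow>L'. fst i u *\<^sub>R ?D (snd i) g (\<phi> u))"
    if g: "smooth_on B g" and u: "u \<in> A" for g u
  proof -
    have "\<phi> u \<in> B" using u A(3) by blast
    then have dg: "?D ks g differentiable (at (\<phi> u))" for ks
      by (rule smooth_on_differentiable [OF smooth_on_dir_derivs [OF g]])
    have comp: "((\<lambda>x. ?D ks g (\<phi> x)) has_derivative
        (\<lambda>w. dir_deriv (dir_deriv w \<phi> u) (?D ks g) (\<phi> u))) (at u)" for ks
      by (rule has_derivative_compose [where f = \<phi>])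
        (intro has_derivative_dir_deriv smooth_on_differentiable [OF A(2) u] dg)+
    have "dir_deriv v (dir_derivs vs (\<lambda>x. g (\<phi> x))) u
      = dir_deriv v (\<lambda>u. \<Sum>i\<leftarrow>L. fst i u *\<^sub>R ?D (snd i) g (\<phi> u)) u"
      by (rule dir_deriv_cong [OF A(1) u]) (rule L [OF g])
    also have "\<dots> = (\<Sum>i\<leftarrow>L. fst i u *\<^sub>R dir_deriv (dir_deriv v \<phi> u) (?D (snd i) g) (\<phi> u)
        + dir_deriv v (fst i) u *\<^sub>R ?D (snd i) g (\<phi> u))"
      by (rule dir_deriv_eq [OF has_derivative_sum_list [OF has_derivative_scaleR
            [OF has_derivative_dir_deriv comp]]])
        (rule smooth_on_differentiable [OF smooth u])
    also have "\<dots> = (\<Sum>i\<leftarrow>L'. fst i u *\<^sub>R ?D (snd i) g (\<phi> u))"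
      unfolding dir_deriv_eq_axis_sum [OF dg, where w = "dir_deriv v \<phi> u"] L'_def
      using ns
      by (simp add: sum_list_concat_map comp_def sum_list_distinct_conv_sum_set scaleR_sum_right
          add.commute)
    finally show ?thesis by simp
  qed
  ultimately show ?case by (intro exI [of _ L'] conjI ballI allI impI)
qed

lemma smooth_on_compose:
  fixes \<phi> :: "'a::real_normed_vector \<Rightarrow> real^'n"
  assumes A: "open A" "smooth_on A \<phi>" "\<phi> ` A \<subseteq> B" and g: "smooth_on B g"
  shows "smooth_on A (\<lambda>x. g (\<phi> x))"
proof (rule smooth_onI_dir_derivs [OF A(1)])
  fix vs
  obtain L where L: "\<And>i. i \<in> set L \<Longrightarrow> smooth_on A (fst i)"
    "\<And>u. u \<in> A \<Longrightarrow> dir_derivs vs (\<lambda>x. g (\<phi> x)) u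
      = (\<Sum>i\<leftarrow>L. fst i u *\<^sub>R axis_derivs (snd i) g (\<phi> u))"
    using dir_derivs_chain [OF A, of vs, where ?'b = 'b] g
    by (elim exE conjE) (rule that, erule (1) bspec, drule spec, drule (1) mp, erule (1) bspec)
  have "(\<lambda>u. \<Sum>i\<leftarrow>L. fst i u *\<^sub>R axis_derivs (snd i) g (\<phi> u)) differentiable (at u)"
    if u: "u \<in> A" for u
  proof (intro differentiable_sum_list differentiable_scaleR)
    show "(\<lambda>u. axis_derivs (snd i) g (\<phi> u)) differentiable (at u)" for i :: "('a \<Rightarrow> real) \<times> 'n list"
      using u A(3)
      by (intro differentiable_compose [OF smooth_on_differentiable [OF smooth_on_dir_derivs [OF g]]
            smooth_on_differentiable [OF A(2)]]) auto
  qed (rule smooth_on_differentiable [OF L(1) u])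
  then show "\<exists>k. (\<forall>u\<in>A. dir_derivs vs (\<lambda>x. g (\<phi> x)) u = k u) \<and> (\<forall>u\<in>A. k differentiable (at u))"
    by (intro exI [of _ "\<lambda>u. \<Sum>i\<leftarrow>L. fst i u *\<^sub>R axis_derivs (snd i) g (\<phi> u)"]
        conjI ballI L(2))
qed


section \<open>Estimates of all derivatives on compact sets\<close>

text \<open>The estimate in the definition of \<open>O_hbar2\<close> on a single coordinate domain. It is separated from the
  manifold, and stated for an arbitrary filter, because its stability properties are pure calculus.\<close>

definition jets_O2 :: "real filter \<Rightarrow> (real^'n) set \<Rightarrow> (real \<Rightarrow> real^'n \<Rightarrow> 'b::real_normed_vector) \<Rightarrow> bool" where
  "jets_O2 F A G \<longleftrightarrow> (\<forall>K js. compact K \<longrightarrow> K \<subseteq> A \<longrightarrow>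
     (\<exists>B. \<forall>\<^sub>F h in F. \<forall>u\<in>K. norm (axis_derivs js (G h) u) \<le> B * h\<^sup>2))"

lemma jets_O2_cong:
  fixes G :: "real \<Rightarrow> real^'n \<Rightarrow> 'b::real_normed_vector"
  assumes "open A" "\<forall>\<^sub>F h in F. \<forall>u\<in>A. G h u = G' h u" "jets_O2 F A G"
  shows "jets_O2 F A G'"
  unfolding jets_O2_def
proof (intro allI impI)
  fix K :: "(real^'n) set" and js :: "'n list" assume K: "compact K" "K \<subseteq> A"
  then obtain B where
    "\<forall>\<^sub>F h in F. \<forall>u\<in>K. norm (axis_derivs js (G h) u) \<le> B * h\<^sup>2"
    using assms(3) unfolding jets_O2_def by blast
  with assms(2) have
    "\<forall>\<^sub>F h in F. \<forall>u\<in>K. norm (axis_derivs js (G' h) u) \<le> B * h\<^sup>2"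
  proof eventually_elim
    case (elim h)
    then show ?case
      using dir_derivs_cong [OF assms(1), of _ "G h" "G' h"] K(2) by (metis subsetD)
  qed
  then show "\<exists>B. \<forall>\<^sub>F h in F. \<forall>u\<in>K. norm (axis_derivs js (G' h) u) \<le> B * h\<^sup>2"
    by blast
qed

lemma jets_O2_add:
  fixes G :: "real \<Rightarrow> real^'n \<Rightarrow> 'b::real_normed_vector"
  assumes "open A" "\<forall>\<^sub>F h in F. smooth_on A (G h)" "\<forall>\<^sub>F h in F. smooth_on A (G' h)"
    and "jets_O2 F A G" "jets_O2 F A G'"
  shows "jets_O2 F A (\<lambda>h u. G h u + G' h u)"
  unfolding jets_O2_def
proof (intro allI impI)
  fix K :: "(real^'n) set" and js :: "'n list" assume K: "compact K" "K \<subseteq> A"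
  obtain B where B: "\<forall>\<^sub>F h in F. \<forall>u\<in>K. norm (axis_derivs js (G h) u) \<le> B * h\<^sup>2"
    using assms(4) K unfolding jets_O2_def by blast
  obtain B' where B': "\<forall>\<^sub>F h in F. \<forall>u\<in>K. norm (axis_derivs js (G' h) u) \<le> B' * h\<^sup>2"
    using assms(5) K unfolding jets_O2_def by blast
  have "\<forall>\<^sub>F h in F. \<forall>u\<in>K. norm (axis_derivs js (\<lambda>u. G h u + G' h u) u) \<le> (B + B') * h\<^sup>2"
    using assms(2,3) B B'
  proof eventually_elim
    case (elim h)
    show ?case
    proof
      fix u assume u: "u \<in> K"
      then have "axis_derivs js (\<lambda>u. G h u + G' h u) u = axis_derivs js (G h) u + axis_derivs js (G' h) u"
        using dir_derivs_add [OF assms(1) elim(1,2)] K(2) by blast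
      then show "norm (axis_derivs js (\<lambda>u. G h u + G' h u) u) \<le> (B + B') * h\<^sup>2"
        using norm_add_rule_thm [OF bspec [OF elim(3) u] bspec [OF elim(4) u]]
        by (simp add: distrib_right)
    qed
  qed
  then show "\<exists>B. \<forall>\<^sub>F h in F. \<forall>u\<in>K. norm (axis_derivs js (\<lambda>u. G h u + G' h u) u) \<le> B * h\<^sup>2"
    by blast
qed

lemma jets_O2_linear:
  fixes G :: "real \<Rightarrow> real^'n \<Rightarrow> 'b::real_normed_vector"
  assumes "open A" "\<forall>\<^sub>F h in F. smooth_on A (G h)" "jets_O2 F A G" "bounded_linear L"
  shows "jets_O2 F A (\<lambda>h u. L (G h u))"
  unfolding jets_O2_def
proof (intro allI impI)
  fix K :: "(real^'n) set" and js :: "'n list" assume K: "compact K" "K \<subseteq> A"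
  obtain B where B: "\<forall>\<^sub>F h in F. \<forall>u\<in>K. norm (axis_derivs js (G h) u) \<le> B * h\<^sup>2"
    using assms(3) K unfolding jets_O2_def by blast
  obtain C where C: "C > 0" "\<And>x. norm (L x) \<le> norm x * C"
    using bounded_linear.pos_bounded [OF assms(4)] by blast
  have "\<forall>\<^sub>F h in F. \<forall>u\<in>K. norm (axis_derivs js (\<lambda>u. L (G h u)) u) \<le> (B * C) * h\<^sup>2"
    using assms(2) B
  proof eventually_elim
    case (elim h)
    show ?case
    proof
      fix u assume u: "u \<in> K"
      then have "norm (axis_derivs js (\<lambda>u. L (G h u)) u)
          = norm (L (axis_derivs js (G h) u))"
        using dir_derivs_linear [OF assms(1) elim(1) assms(4)] K(2) by (metis subsetD)
      also have "\<dots> \<le> norm (axis_derivs js (G h) u) * C"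
        by (rule C)
      also have "\<dots> \<le> (B * h\<^sup>2) * C"
        using elim(2) u C(1) by (intro mult_right_mono) auto
      finally show "norm (axis_derivs js (\<lambda>u. L (G h u)) u) \<le> (B * C) * h\<^sup>2"
        by (simp add: mult_ac)
    qed
  qed
  then show "\<exists>B. \<forall>\<^sub>F h in F. \<forall>u\<in>K. norm (axis_derivs js (\<lambda>u. L (G h u)) u) \<le> B * h\<^sup>2"
    by blast
qed

lemma sum_list_norm_le:
  assumes "\<And>i. i \<in> set L \<Longrightarrow> norm (f i) \<le> b i"
  shows "norm (\<Sum>i\<leftarrow>L. f i) \<le> (\<Sum>i\<leftarrow>L. b i)"
  using assms by (induction L) (auto intro: norm_triangle_le add_mono)

text \<open>By \<open>dir_derivs_chain\<close>: the coefficients are continuous, so bounded on the compact set, and the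
  derivatives of \<open>G h\<close> are evaluated on the compact image.\<close>

lemma jets_O2_compose:
  fixes \<phi> :: "real^'n \<Rightarrow> real^'m" and G :: "real \<Rightarrow> real^'m \<Rightarrow> 'b::real_normed_vector"
  assumes A: "open A" "smooth_on A \<phi>" "\<phi> ` A \<subseteq> B"
    and G: "\<forall>\<^sub>F h in F. smooth_on B (G h)" "jets_O2 F B G"
  shows "jets_O2 F A (\<lambda>h u. G h (\<phi> u))"
  unfolding jets_O2_def
proof (intro allI impI)
  fix K :: "(real^'n) set" and js :: "'n list" assume K: "compact K" "K \<subseteq> A"
  let ?D = axis_derivs
  obtain L where L: "\<And>i. i \<in> set L \<Longrightarrow> smooth_on A (fst i)"
    "\<And>g u. smooth_on B g \<Longrightarrow> u \<in> A \<Longrightarrow> axis_derivs js (\<lambda>x. (g :: real^'m \<Rightarrow> 'b) (\<phi> x)) u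
      = (\<Sum>i\<leftarrow>L. fst i u *\<^sub>R ?D (snd i) g (\<phi> u))"
    using dir_derivs_chain [OF A, of "map (\<lambda>j. axis j 1) js", where ?'b = 'b]
    by (elim exE conjE) (rule that, erule (1) bspec, drule spec, drule (1) mp, erule (1) bspec)
  have "\<exists>C. \<forall>u\<in>K. \<bar>fst i u\<bar> \<le> C" if "i \<in> set L" for i
  proof -
    have "compact (fst i ` K)"
      using smooth_on_continuous [OF L(1) [OF that]] K
      by (intro compact_continuous_image) (auto intro: continuous_on_subset)
    then show ?thesis
      using compact_imp_bounded by (fastforce simp: bounded_iff)
  qed
  then obtain C where C: "\<And>i u. i \<in> set L \<Longrightarrow> u \<in> K \<Longrightarrow> \<bar>fst i u\<bar> \<le> C i"
    by metis
  have "compact (\<phi> ` K)" "\<phi> ` K \<subseteq> B"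
    using smooth_on_continuous [OF A(2)] K A(3)
    by (auto intro!: compact_continuous_image intro: continuous_on_subset)
  then have "\<forall>ks. \<exists>b. \<forall>\<^sub>F h in F. \<forall>u\<in>\<phi> ` K. norm (?D ks (G h) u) \<le> b * h\<^sup>2"
    using G(2) unfolding jets_O2_def by blast
  from choice [OF this] obtain b
    where b: "\<forall>ks. \<forall>\<^sub>F h in F. \<forall>u\<in>\<phi> ` K. norm (?D ks (G h) u) \<le> b ks * h\<^sup>2" ..
  have "\<forall>\<^sub>F h in F. \<forall>i\<in>set L. \<forall>u\<in>\<phi> ` K. norm (?D (snd i) (G h) u) \<le> b (snd i) * h\<^sup>2"
    using b by (intro eventually_ball_finite) auto
  with G(1) have "\<forall>\<^sub>F h in F. \<forall>u\<in>K. norm (axis_derivs js (\<lambda>u. G h (\<phi> u)) u)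
      \<le> (\<Sum>i\<leftarrow>L. C i * b (snd i)) * h\<^sup>2"
  proof eventually_elim
    case (elim h)
    show ?case
    proof
      fix u assume u: "u \<in> K"
      have "norm (fst i u *\<^sub>R ?D (snd i) (G h) (\<phi> u)) \<le> C i * b (snd i) * h\<^sup>2" if "i \<in> set L" for i
      proof -
        have "norm (?D (snd i) (G h) (\<phi> u)) \<le> b (snd i) * h\<^sup>2"
          using elim(2) that u by blast
        moreover have "0 \<le> C i"
          using C [OF that u] by linarith
        ultimately have "\<bar>fst i u\<bar> * norm (?D (snd i) (G h) (\<phi> u)) \<le> C i * (b (snd i) * h\<^sup>2)"
          using C [OF that u] by (intro mult_mono) auto
        then show ?thesis by (simp add: mult.assoc)
      qed
      then have "norm (\<Sum>i\<leftarrow>L. fst i u *\<^sub>R ?D (snd i) (G h) (\<phi> u)) \<le> (\<Sum>i\<leftarrow>L. C i * b (snd i) * h\<^sup>2)"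
        by (rule sum_list_norm_le)
      also have "\<dots> = (\<Sum>i\<leftarrow>L. C i * b (snd i)) * h\<^sup>2"
        by (simp add: sum_list_mult_const)
      finally show "norm (axis_derivs js (\<lambda>u. G h (\<phi> u)) u)
          \<le> (\<Sum>i\<leftarrow>L. C i * b (snd i)) * h\<^sup>2"
        unfolding L(2) [OF elim(1) subsetD [OF K(2) u]] .
    qed
  qed
  then show "\<exists>B. \<forall>\<^sub>F h in F. \<forall>u\<in>K. norm (axis_derivs js (\<lambda>u. G h (\<phi> u)) u) \<le> B * h\<^sup>2"
    by blast
qed

text \<open>A compact set is covered by finitely many balls on which the estimate holds. Since the estimate holds
  only eventually, finiteness is used twice: for the constant and for the threshold in \<open>h\<close>.\<close>

lemma jets_O2_local:
  fixes G :: "real \<Rightarrow> real^'n \<Rightarrow> 'b::real_normed_vector"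
  assumes "\<And>u. u \<in> A \<Longrightarrow> \<exists>N. open N \<and> u \<in> N \<and> jets_O2 F N G"
  shows "jets_O2 F A G"
  unfolding jets_O2_def
proof (intro allI impI)
  fix K :: "(real^'n) set" and js :: "'n list" assume K: "compact K" "K \<subseteq> A"
  let ?D = "\<lambda>h u. axis_derivs js (G h) u"
  have "\<exists>e b. e > 0 \<and> (\<forall>\<^sub>F h in F. \<forall>v\<in>ball u e. norm (?D h v) \<le> b * h\<^sup>2)" if u: "u \<in> K" for u
  proof -
    obtain N where N: "open N" "u \<in> N" "jets_O2 F N G"
      using assms [OF subsetD [OF K(2) u]] by (elim exE conjE)
    obtain e where e: "e > 0" "cball u e \<subseteq> N"
      using N(1,2) by (meson open_contains_cball)
    obtain b where b: "\<forall>\<^sub>F h in F. \<forall>v\<in>cball u e. norm (?D h v) \<le> b * h\<^sup>2"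
      using N(3) e(2) compact_cball [of u e] unfolding jets_O2_def by blast
    have "\<forall>\<^sub>F h in F. \<forall>v\<in>ball u e. norm (?D h v) \<le> b * h\<^sup>2"
      using b by eventually_elim auto
    with e(1) show ?thesis by blast
  qed
  then have "\<forall>u\<in>K. \<exists>e b. e > 0 \<and> (\<forall>\<^sub>F h in F. \<forall>v\<in>ball u e. norm (?D h v) \<le> b * h\<^sup>2)"
    by blast
  from bchoice [OF this] obtain e where
    "\<forall>u\<in>K. \<exists>b. e u > 0 \<and> (\<forall>\<^sub>F h in F. \<forall>v\<in>ball u (e u). norm (?D h v) \<le> b * h\<^sup>2)" ..
  from bchoice [OF this] obtain b where eb:
    "\<forall>u\<in>K. e u > 0 \<and> (\<forall>\<^sub>F h in F. \<forall>v\<in>ball u (e u). norm (?D h v) \<le> b u * h\<^sup>2)" ..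
  obtain S where S: "S \<subseteq> K" "finite S" "K \<subseteq> (\<Union>u\<in>S. ball u (e u))"
    using compactE_image [OF K(1), of K "\<lambda>u. ball u (e u)"] eb by force
  have "\<forall>\<^sub>F h in F. \<forall>u\<in>S. \<forall>v\<in>ball u (e u). norm (?D h v) \<le> b u * h\<^sup>2"
    using S(1,2) eb by (intro eventually_ball_finite) blast+
  then have "\<forall>\<^sub>F h in F. \<forall>v\<in>K. norm (?D h v) \<le> (\<Sum>u\<in>S. \<bar>b u\<bar>) * h\<^sup>2"
  proof eventually_elim
    case (elim h)
    show ?case
    proof
      fix v assume "v \<in> K"
      then obtain u where u: "u \<in> S" "v \<in> ball u (e u)" using S(3) by blast
      have "b u \<le> (\<Sum>u\<in>S. \<bar>b u\<bar>)"
        using member_le_sum [of u S "\<lambda>u. \<bar>b u\<bar>"] u(1) S(2) by simp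
      then have "b u * h\<^sup>2 \<le> (\<Sum>u\<in>S. \<bar>b u\<bar>) * h\<^sup>2"
        by (intro mult_right_mono) auto
      with elim u show "norm (?D h v) \<le> (\<Sum>u\<in>S. \<bar>b u\<bar>) * h\<^sup>2"
        by fastforce
    qed
  qed
  then show "\<exists>B. \<forall>\<^sub>F h in F. \<forall>u\<in>K. norm (?D h u) \<le> B * h\<^sup>2"
    by blast
qed

lemma smooth_on_local:
  assumes "\<And>u. u \<in> A \<Longrightarrow> \<exists>N. u \<in> N \<and> smooth_on N f"
  shows "smooth_on A f"
  using assms unfolding smooth_on_def by blast

section \<open>Linearity of the quantization\<close>

context ether_quantization
begin

lemma chart_at: "chart_at Q p \<in> atlas Q" "p \<in> cdom (chart_at Q p)"
proof -
  have "p \<in> (\<Union>c\<in>atlas Q. cdom c)" using atlas by (simp add: smooth_atlas_def)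
  then have "\<exists>c. c \<in> atlas Q \<and> p \<in> cdom c" by blast
  from someI_ex [OF this] show "chart_at Q p \<in> atlas Q" "p \<in> cdom (chart_at Q p)"
    by (simp_all add: chart_at_def)
qed

lemma core_add: "\<lbrakk>h \<in> hbars Q; u \<in> core Q h; v \<in> core Q h\<rbrakk> \<Longrightarrow> u + v \<in> core Q h"
  and core_scaleC: "\<lbrakk>h \<in> hbars Q; u \<in> core Q h\<rbrakk> \<Longrightarrow> a *\<^sub>C u \<in> core Q h"
  and core_closure: "h \<in> hbars Q \<Longrightarrow> closure (core Q h) = UNIV"
  using core_dense by (simp_all add: dense_subspace_def)

lemma core_diff: "\<lbrakk>h \<in> hbars Q; u \<in> core Q h; v \<in> core Q h\<rbrakk> \<Longrightarrow> u - v \<in> core Q h"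
  using core_add [of h u "(-1) *\<^sub>C v"] core_scaleC [of h v "-1"]
  by (simp add: scaleC.minus_left scaleC_one)

lemma quantize_eqI:
  assumes "h \<in> hbars Q" "weak_quantization Q h f \<psi> v"
  shows "quantize Q h f \<psi> = v"
  unfolding quantize_def
proof (rule the_equality)
  fix w assume "weak_quantization Q h f \<psi> w"
  then show "w = v"
    using assms eq_of_cinner_dense [OF core_dense, of h w v] by (simp add: weak_quantization_def)
qed fact

text \<open>The quantization is a definite description; for symbols the described vector exists, so the
  linearity of the weak integral in the symbol and in the vector becomes that of the operator.\<close>

lemma
  assumes "f \<in> symbols Q" "h \<in> hbars Q" "\<psi> \<in> core Q h"
  shows weak_quantization_quantize: "weak_quantization Q h (f h) \<psi> (quantize Q h (f h) \<psi>)"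
    and quantize_in_core: "quantize Q h (f h) \<psi> \<in> core Q h"
  using quantizable [OF assms] quantize_eqI [OF assms(2)] by metis+

lemma quantize_symbol_add:
  assumes "f \<in> symbols Q" "g \<in> symbols Q" "h \<in> hbars Q" "\<psi> \<in> core Q h"
  shows "quantize Q h (\<lambda>x. f h x + g h x) \<psi> = quantize Q h (f h) \<psi> + quantize Q h (g h) \<psi>"
  using weak_quantization_quantize [of f h \<psi>] weak_quantization_quantize [of g h \<psi>] assms
  by (intro quantize_eqI)
    (auto simp: weak_quantization_def ring_distribs cinner_add_right)

lemma quantize_symbol_scale:
  assumes "f \<in> symbols Q" "h \<in> hbars Q" "\<psi> \<in> core Q h"
  shows "quantize Q h (\<lambda>x. a * f h x) \<psi> = a *\<^sub>C quantize Q h (f h) \<psi>"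
  using weak_quantization_quantize [of f h \<psi>] assms
  by (intro quantize_eqI) (auto simp: weak_quantization_def mult.assoc cinner_scaleC_right)

lemma quantize_vector_add:
  assumes "f \<in> symbols Q" "h \<in> hbars Q" "\<psi> \<in> core Q h" "\<phi> \<in> core Q h"
  shows "quantize Q h (f h) (\<psi> + \<phi>) = quantize Q h (f h) \<psi> + quantize Q h (f h) \<phi>"
  using weak_quantization_quantize [of f h \<psi>] weak_quantization_quantize [of f h \<phi>]
    S_linear [of h] assms
  by (intro quantize_eqI)
    (auto simp: weak_quantization_def complex_linear_def ring_distribs cinner_add_right)

lemma quantize_vector_scale:
  assumes "f \<in> symbols Q" "h \<in> hbars Q" "\<psi> \<in> core Q h"
  shows "quantize Q h (f h) (a *\<^sub>C \<psi>) = a *\<^sub>C quantize Q h (f h) \<psi>"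
  using weak_quantization_quantize [of f h \<psi>] S_linear [of h] assms
  by (intro quantize_eqI)
    (auto simp: weak_quantization_def complex_linear_def cinner_scaleC_right mult.left_commute)

lemma symbols_sum:
  assumes "finite S" "\<And>k. k \<in> S \<Longrightarrow> f k \<in> symbols Q"
  shows "(\<lambda>h x. \<Sum>k\<in>S. a k *\<^sub>R f k h x) \<in> symbols Q"
  using assms
proof (induction S)
  case empty
  show ?case using symbols_scale [OF symbols_one, of 0] by simp
next
  case (insert k S)
  then show ?case
    using symbols_add [OF symbols_scale [of "f k" "of_real (a k)"]]
    by (simp add: scaleR_conv_of_real)
qed

lemma quantize_symbol_sum:
  assumes "finite S" "\<And>k. k \<in> S \<Longrightarrow> f k \<in> symbols Q" "h \<in> hbars Q" "\<psi> \<in> core Q h"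
  shows "quantize Q h (\<lambda>x. \<Sum>k\<in>S. a k *\<^sub>R f k h x) \<psi> = (\<Sum>k\<in>S. a k *\<^sub>R quantize Q h (f k h) \<psi>)"
  using assms
proof (induction S)
  case empty
  show ?case using quantize_symbol_scale [OF symbols_one, of h \<psi> 0] empty by (simp add: scaleC.zero_left)
next
  case (insert k S)
  then have "quantize Q h (\<lambda>x. a k *\<^sub>R f k h x + (\<Sum>k\<in>S. a k *\<^sub>R f k h x)) \<psi>
    = quantize Q h (\<lambda>x. a k *\<^sub>R f k h x) \<psi> + quantize Q h (\<lambda>x. \<Sum>k\<in>S. a k *\<^sub>R f k h x) \<psi>"
    using symbols_sum [of S f a] symbols_sum [of "{k}" f a]
    by (intro quantize_symbol_add [where f = "\<lambda>h x. a k *\<^sub>R f k h x"]) auto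
  with insert show ?case
    using quantize_symbol_scale [of "f k" h \<psi> "of_real (a k)"]
    by (simp add: scaleR_conv_of_real scaleR_scaleC)
qed


section \<open>Quantum paths as unique unitary evolutions\<close>

definition path_ham :: "real \<Rightarrow> (real \<Rightarrow> 'x) \<Rightarrow> real \<Rightarrow> 'x \<Rightarrow> complex" where
  "path_ham h \<gamma> t = contract_velocity Q (qether Q h) \<gamma> t"

lemma path_ham_eq:
  "path_ham h \<gamma> t = (\<lambda>z. \<Sum>k\<in>UNIV. velocity (chart_at Q (\<gamma> t)) \<gamma> t $ k *\<^sub>R
    qether Q h (chart_at Q (\<gamma> t)) (\<gamma> t) z $ k)"
  by (simp add: fun_eq_iff path_ham_def contract_velocity_def Let_def)

lemma path_ham_symbol: "(\<lambda>h. path_ham h \<gamma> t) \<in> symbols Q"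
  unfolding path_ham_eq
  by (intro symbols_sum qether_symbol chart_at finite)

lemma quantize_path_ham:
  assumes "h \<in> hbars Q" "\<phi> \<in> core Q h"
  shows "quantize Q h (path_ham h \<gamma> t) \<phi> =
    (\<Sum>k\<in>UNIV. velocity (chart_at Q (\<gamma> t)) \<gamma> t $ k *\<^sub>R
      quantize Q h (\<lambda>z. qether Q h (chart_at Q (\<gamma> t)) (\<gamma> t) z $ k) \<phi>)"
  using quantize_symbol_sum [where S = UNIV and a = "\<lambda>k. velocity (chart_at Q (\<gamma> t)) \<gamma> t $ k"
      and f = "\<lambda>k h z. qether Q h (chart_at Q (\<gamma> t)) (\<gamma> t) z $ k", OF finite _ assms]
    qether_symbol [OF chart_at]
  by (simp add: path_ham_eq)

lemma path_ham_expectation_real: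
  assumes "h \<in> hbars Q" "\<phi> \<in> core Q h"
  shows "Im (cinner \<phi> (quantize Q h (path_ham h \<gamma> t) \<phi>)) = 0"
proof -
  define c where "c = chart_at Q (\<gamma> t)"
  have "Im (cinner \<phi> (quantize Q h (\<lambda>z. qether Q h c (\<gamma> t) z $ k) \<phi>)) = 0" for k
  proof -
    have "cinner \<phi> (quantize Q h (\<lambda>z. qether Q h c (\<gamma> t) z $ k) \<phi>)
      = cnj (cinner \<phi> (quantize Q h (\<lambda>z. qether Q h c (\<gamma> t) z $ k) \<phi>))"
      unfolding c_def
      using qether_symmetric [OF assms(1) chart_at assms(2) assms(2), of _ k] cinner_commute
      by metis
    then show ?thesis by (metis Reals_cnj_iff complex_is_Real_iff)
  qed
  then show ?thesis
    by (simp add: quantize_path_ham assms c_def [symmetric] cinner_sum_right scaleR_scaleC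
        cinner_scaleC_right)
qed

text \<open>The right-hand side of the equation of the quantum path, solved for the derivative.\<close>

definition path_velocity :: "real \<Rightarrow> (real \<Rightarrow> 'x) \<Rightarrow> real \<Rightarrow> 'h \<Rightarrow> 'h" where
  "path_velocity h \<gamma> t \<phi> = (- \<i> / (2 * complex_of_real h)) *\<^sub>C quantize Q h (path_ham h \<gamma> t) \<phi>"

lemma path_velocity_diff:
  assumes "h \<in> hbars Q" "\<phi> \<in> core Q h" "\<psi> \<in> core Q h"
  shows "path_velocity h \<gamma> t (\<phi> - \<psi>) = path_velocity h \<gamma> t \<phi> - path_velocity h \<gamma> t \<psi>"
  using quantize_vector_add [OF path_ham_symbol assms(1) core_diff [OF assms] assms(3), of \<gamma> t]
  by (simp add: path_velocity_def scaleC.diff_right [symmetric])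

text \<open>The infinitesimal form of unitarity: a symmetric operator has real expectation values, and the
  factor \<open>- i\<close> turns them into vectors orthogonal to the state.\<close>

lemma path_velocity_orthogonal:
  assumes "h \<in> hbars Q" "\<phi> \<in> core Q h"
  shows "inner \<phi> (path_velocity h \<gamma> t \<phi>) = 0"
  using path_ham_expectation_real [OF assms, of \<gamma> t]
  by (simp add: Re_cinner [symmetric] path_velocity_def cinner_scaleC_right Re_divide)

lemma quantum_evolution_unitary:
  assumes "quantum_evolution Q h \<gamma> T U" "t \<in> closed_segment 0 T"
  shows "unitary_operator (U t)"
  using assms by (simp add: quantum_evolution_def)

lemma quantum_evolution_core:
  assumes "quantum_evolution Q h \<gamma> T U" "t \<in> closed_segment 0 T" "\<psi> \<in> core Q h"
  shows "U t \<psi> \<in> core Q h"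
proof -
  have "U t ` core Q h = core Q h"
    using assms by (simp add: quantum_evolution_def)
  then show ?thesis using assms(3) by blast
qed

lemma quantum_evolution_derivative:
  assumes U: "quantum_evolution Q h \<gamma> T U" and h: "h \<in> hbars Q"
    and t: "t \<in> closed_segment 0 T" and \<psi>: "\<psi> \<in> core Q h"
  shows "((\<lambda>\<tau>. U \<tau> \<psi>) has_vector_derivative path_velocity h \<gamma> t (U t \<psi>))
    (at t within closed_segment 0 T)"
proof -
  define K where "K = quantize Q h (path_ham h \<gamma> t) (U t \<psi>)"
  have core: "U t \<psi> \<in> core Q h"
    using quantum_evolution_core [OF U t \<psi>] .
  obtain V where V: "((\<lambda>\<tau>. U \<tau> \<psi>) has_vector_derivative V) (at t within closed_segment 0 T)"
      "(\<i> * complex_of_real h) *\<^sub>C V = (1/2) *\<^sub>R K"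
    using U t \<psi> chart_at [of "\<gamma> t"]
    unfolding quantum_evolution_def K_def quantize_path_ham [OF h core] by blast
  have "h \<noteq> 0" using h hbars_pos by auto
  then have "V = (1 / (\<i> * complex_of_real h)) *\<^sub>C (\<i> * complex_of_real h) *\<^sub>C V"
    by (simp add: scaleC_scaleC scaleC_one)
  also have "\<dots> = (- \<i> / (2 * complex_of_real h)) *\<^sub>C K"
  proof -
    have "1 / (\<i> * complex_of_real h) * (1 / 2) = - \<i> / (2 * complex_of_real h)"
      using \<open>h \<noteq> 0\<close> by (simp add: divide_simps)
    then show ?thesis
      by (simp add: V(2) scaleR_scaleC scaleC_scaleC)
  qed
  finally show ?thesis using V(1) by (simp add: path_velocity_def K_def)
qed

text \<open>The difference of two solutions is again a solution, with values in the core. By orthogonality of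
  velocity and state its norm is constant, and it vanishes at the origin. Density of the core
  extends the equality from core vectors to the unitary operators.\<close>

lemma quantum_evolution_unique:
  assumes U: "quantum_evolution Q h \<gamma> T U" and V: "quantum_evolution Q h \<gamma> T V"
    and h: "h \<in> hbars Q" and t: "t \<in> closed_segment 0 T"
  shows "U t = V t"
proof (rule unitary_operator_eq_of_dense [OF _ _ core_closure [OF h]])
  fix \<psi> assume \<psi>: "\<psi> \<in> core Q h"
  define D where "D \<tau> = U \<tau> \<psi> - V \<tau> \<psi>" for \<tau>
  have deriv: "((\<lambda>\<tau>. inner (D \<tau>) (D \<tau>)) has_vector_derivative 0) (at s within closed_segment 0 T)"
    if s: "s \<in> closed_segment 0 T" for s
  proof -
    have core: "U s \<psi> \<in> core Q h" "V s \<psi> \<in> core Q h"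
      using quantum_evolution_core s \<psi> U V by blast+
    have "(D has_vector_derivative path_velocity h \<gamma> s (D s)) (at s within closed_segment 0 T)"
      unfolding D_def path_velocity_diff [OF h core]
      by (intro has_vector_derivative_diff quantum_evolution_derivative U V h s \<psi>)
    then have "((\<lambda>\<tau>. inner (D \<tau>) (D \<tau>)) has_vector_derivative
        inner (D s) (path_velocity h \<gamma> s (D s)) + inner (path_velocity h \<gamma> s (D s)) (D s))
        (at s within closed_segment 0 T)"
      by (intro bounded_bilinear.has_vector_derivative [OF bounded_bilinear_inner])
    moreover have "D s \<in> core Q h"
      using core_diff [OF h core] by (simp add: D_def)
    ultimately show ?thesis
      using path_velocity_orthogonal [OF h] by (simp add: inner_commute)
  qed
  obtain c where c: "\<And>s. s \<in> closed_segment 0 T \<Longrightarrow> inner (D s) (D s) = c"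
    using has_vector_derivative_zero_constant [OF convex_closed_segment deriv] by blast
  have "D 0 = 0"
    using U V by (simp add: D_def quantum_evolution_def)
  with c [of 0] c [OF t] show "U t \<psi> = V t \<psi>"
    by (simp add: D_def)
qed (use U V t in \<open>blast intro: quantum_evolution_unitary\<close>)+

lemma quantum_evolution_restrict:
  assumes U: "quantum_evolution Q h \<gamma> T U" and t: "t \<in> closed_segment 0 T"
  shows "quantum_evolution Q h \<gamma> t U"
proof -
  have "closed_segment 0 t \<subseteq> closed_segment 0 T"
    using t by (simp add: subset_closed_segment)
  then show ?thesis
    using U unfolding quantum_evolution_def
    by (blast intro: has_vector_derivative_within_subset)
qed

lemma quantum_path_eq_evolution:
  assumes U: "quantum_evolution Q h \<gamma> T U" and h: "h \<in> hbars Q" and t: "t \<in> closed_segment 0 T"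
  shows "quantum_path Q h \<gamma> t = U t"
  unfolding quantum_path_def
proof (rule the_equality)
  show "\<exists>V. quantum_evolution Q h \<gamma> t V \<and> V t = U t"
    using quantum_evolution_restrict [OF U t] by blast
  show "W = U t" if "\<exists>V. quantum_evolution Q h \<gamma> t V \<and> V t = W" for W
    using that quantum_evolution_unique [OF _ quantum_evolution_restrict [OF U t] h] by blast
qed

text \<open>The operators assigned to the initial segments of a path form one evolution. This is what allows
  differentiation with respect to the end point.\<close>

lemma quantum_path_evolution:
  assumes "h \<in> hbars Q" "smooth_path (atlas Q) \<gamma> T"
  shows "quantum_evolution Q h \<gamma> T (quantum_path Q h \<gamma>)"
proof -
  obtain U where U: "quantum_evolution Q h \<gamma> T U"
    using quantum_path_exists [OF assms] by blast
  have eq: "quantum_path Q h \<gamma> t = U t" if "t \<in> closed_segment 0 T" for t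
    using quantum_path_eq_evolution [OF U assms(1) that] .
  show ?thesis
    unfolding quantum_evolution_def
  proof (intro conjI ballI impI)
    show "quantum_path Q h \<gamma> 0 = id"
      using U by (simp add: eq quantum_evolution_def)
    fix \<psi> t c assume *: "\<psi> \<in> core Q h" "t \<in> closed_segment 0 T" "c \<in> atlas Q" "\<gamma> t \<in> cdom c"
    then obtain V where V: "((\<lambda>\<tau>. U \<tau> \<psi>) has_vector_derivative V) (at t within closed_segment 0 T)"
      "(\<i> * complex_of_real h) *\<^sub>C V = (1/2) *\<^sub>R (\<Sum>k\<in>UNIV. velocity c \<gamma> t $ k
                            *\<^sub>R quantize Q h (\<lambda>z. qether Q h c (\<gamma> t) z $ k) (U t \<psi>))"
      using U unfolding quantum_evolution_def by blast
    have "((\<lambda>\<tau>. quantum_path Q h \<gamma> \<tau> \<psi>) has_vector_derivative V) (at t within closed_segment 0 T)"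
      by (rule has_vector_derivative_transform [OF *(2) _ V(1)]) (simp add: eq)
    with V(2) show "\<exists>V. ((\<lambda>\<tau>. quantum_path Q h \<gamma> \<tau> \<psi>) has_vector_derivative V) (at t within closed_segment 0 T)
      \<and> (\<i> * complex_of_real h) *\<^sub>C V = (1/2) *\<^sub>R (\<Sum>k\<in>UNIV. velocity c \<gamma> t $ k
                            *\<^sub>R quantize Q h (\<lambda>z. qether Q h c (\<gamma> t) z $ k) (quantum_path Q h \<gamma> t \<psi>))"
      using eq *(2) by auto
  qed (use U eq in \<open>simp_all add: quantum_evolution_def\<close>)
qed

lemma smooth_path_of_curve:
  assumes "open J" "is_interval J" "0 \<in> J" "smooth_curve (atlas Q) J \<gamma>" "t \<in> J"
  shows "smooth_path (atlas Q) \<gamma> t"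
proof -
  have "closed_segment 0 t \<subseteq> J"
    using assms by (intro closed_segment_subset) (auto simp: is_interval_convex_1)
  then show ?thesis using assms(1,4) by (auto simp: smooth_path_def)
qed

text \<open>The two-sided derivative at \<open>t\<close> comes from an end point of the path beyond \<open>t\<close>.\<close>

lemma quantum_path_derivative:
  assumes h: "h \<in> hbars Q" and J: "open J" "is_interval J" "0 \<in> J"
    and \<gamma>: "smooth_curve (atlas Q) J \<gamma>" and t: "t \<in> J" and \<phi>: "\<phi> \<in> core Q h"
  shows "((\<lambda>\<tau>. quantum_path Q h \<gamma> \<tau> \<phi>) has_vector_derivative
    path_velocity h \<gamma> t (quantum_path Q h \<gamma> t \<phi>)) (at t)"
proof -
  let ?w = "path_velocity h \<gamma> t (quantum_path Q h \<gamma> t \<phi>)"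
  have within: "((\<lambda>\<tau>. quantum_path Q h \<gamma> \<tau> \<phi>) has_vector_derivative ?w)
      (at t within closed_segment 0 T)" if "T \<in> J" "t \<in> closed_segment 0 T" for T
    using that
    by (intro quantum_evolution_derivative [OF quantum_path_evolution [OF h]] h \<phi>
        smooth_path_of_curve [OF J \<gamma>])
  obtain e where e: "e > 0" "cball t e \<subseteq> J"
    using J(1) t open_contains_cball by blast
  then have ends: "t - e \<in> J" "t + e \<in> J"
    by (auto simp: dist_norm)
  show ?thesis
  proof (cases "t = 0")
    case True
    \<comment> \<open>At the origin the path is known only as two one-sided evolutions, with the same velocity.\<close>
    have "((\<lambda>\<tau>. quantum_path Q h \<gamma> \<tau> \<phi>) has_vector_derivative ?w)
        (at t within closed_segment 0 (- e) \<union> closed_segment 0 e)"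
      using within [of "- e"] within [of e] ends True
      by (auto simp: has_vector_derivative_def has_derivative_within intro: Lim_Un)
    moreover have "closed_segment 0 (- e) \<union> closed_segment 0 e = {- e..e}"
      using e(1) by (auto simp: closed_segment_eq_real_ivl)
    moreover have "t \<in> interior {- e..e}"
      using e(1) True by simp
    ultimately show ?thesis by (simp only: at_within_interior)
  next
    case False
    define T where "T = (if t > 0 then t + e else t - e)"
    have T: "T \<in> J" "t \<in> closed_segment 0 T" "t \<in> interior (closed_segment 0 T)"
      using ends e(1) False by (auto simp: T_def closed_segment_eq_real_ivl)
    show ?thesis
      using within [OF T(1,2)] unfolding at_within_interior [OF T(3)] .
  qed
qed

section \<open>The permutation formula\<close>

text \<open>The pullback is a definite description of a symbol; injectivity of the quantization makes the
  described symbol unique.\<close>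

lemma quantum_pullback_quantize:
  assumes "smooth_path (atlas Q) \<gamma> T" "f \<in> symbols Q" "h \<in> hbars Q"
  obtains g where "g \<in> symbols Q" "g h = quantum_pullback Q h \<gamma> T (f h)"
    "\<And>\<psi>. \<psi> \<in> core Q h \<Longrightarrow> quantize Q h (g h) \<psi> =
      inv (quantum_path Q h \<gamma> T) (quantize Q h (f h) (quantum_path Q h \<gamma> T \<psi>))"
proof -
  obtain g where g: "g \<in> symbols Q" "\<And>\<psi>. \<psi> \<in> core Q h \<Longrightarrow> quantize Q h (g h) \<psi> =
      inv (quantum_path Q h \<gamma> T) (quantize Q h (f h) (quantum_path Q h \<gamma> T \<psi>))"
    using quantum_pullback_exists [OF assms(1,2)] assms(3) by blast
  have "quantum_pullback Q h \<gamma> T (f h) = g h"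
    unfolding quantum_pullback_def
  proof (rule the_equality)
    show "g h \<in> (\<lambda>F. F h) ` symbols Q \<and> (\<forall>\<psi>\<in>core Q h. quantize Q h (g h) \<psi> =
           inv (quantum_path Q h \<gamma> T) (quantize Q h (f h) (quantum_path Q h \<gamma> T \<psi>)))"
      using g by blast
  next
    fix k assume "k \<in> (\<lambda>F. F h) ` symbols Q \<and> (\<forall>\<psi>\<in>core Q h. quantize Q h k \<psi> =
           inv (quantum_path Q h \<gamma> T) (quantize Q h (f h) (quantum_path Q h \<gamma> T \<psi>)))"
    then obtain F where F: "F \<in> symbols Q" "k = F h"
      "\<And>\<psi>. \<psi> \<in> core Q h \<Longrightarrow> quantize Q h (F h) \<psi> =
           inv (quantum_path Q h \<gamma> T) (quantize Q h (f h) (quantum_path Q h \<gamma> T \<psi>))"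
      by blast
    show "k = g h"
      unfolding F(2) by (rule quantize_inj [OF F(1) g(1) assms(3)]) (simp add: F(3) g(2))
  qed
  with g that show thesis by metis
qed

lemma symbols_diff:
  assumes "f \<in> symbols Q" "g \<in> symbols Q"
  shows "(\<lambda>h x. f h x - a * g h x) \<in> symbols Q"
  using symbols_add [OF assms(1) symbols_scale [OF assms(2), of "- a"]] by simp

lemma quantize_symbol_diff:
  assumes "f \<in> symbols Q" "g \<in> symbols Q" "h \<in> hbars Q" "\<psi> \<in> core Q h"
  shows "quantize Q h (\<lambda>x. f h x - a * g h x) \<psi> = quantize Q h (f h) \<psi> - a *\<^sub>C quantize Q h (g h) \<psi>"
  using quantize_symbol_add [OF assms(1) symbols_scale [OF assms(2), of "- a"] assms(3,4)]
    quantize_symbol_scale [OF assms(2-4), of "- a"]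
  by (simp add: scaleC.minus_left)

text \<open>The translocation formula for a curve \<open>\<gamma>\<close>, a symbol \<open>f\<close> and an energy \<open>E\<close>; for the theorem these are
  the trajectory of \<open>y\<close>, the function \<open>H\<close> and the value \<open>H(y)\<close>. The quantum path is pulled out
  to the left by inserting its inverse, which turns the operators standing before it into the pullback.\<close>

lemma permutation_formula:
  fixes E :: real
  assumes h: "h \<in> hbars Q" and J: "open J" "is_interval J" "0 \<in> J"
    and \<gamma>: "smooth_curve (atlas Q) J \<gamma>" and t: "t \<in> J" and f: "f \<in> symbols Q"
    and \<psi>: "\<psi> t \<in> core Q h" "\<psi> differentiable (at t)"
  defines "e \<equiv> \<lambda>\<tau>. exp (- (\<i> / complex_of_real h) * complex_of_real (E * \<tau>))"
    and "G \<equiv> \<lambda>\<tau> z. quantum_pullback Q h \<gamma> \<tau> (\<lambda>w. f h w - 1/2 * path_ham h \<gamma> \<tau> w) z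
        - complex_of_real E"
  shows "(\<lambda>\<tau>. e \<tau> *\<^sub>C quantum_path Q h \<gamma> \<tau> (\<psi> \<tau>)) differentiable (at t)"
    and "time_operator h (\<lambda>_. quantize Q h (f h)) (\<lambda>\<tau>. e \<tau> *\<^sub>C quantum_path Q h \<gamma> \<tau> (\<psi> \<tau>)) t
      = e t *\<^sub>C quantum_path Q h \<gamma> t (time_operator h (\<lambda>\<tau>. quantize Q h (G \<tau>)) \<psi> t)"
proof -
  let ?W = "quantum_path Q h \<gamma>"
  have "h \<noteq> 0" using h hbars_pos by auto
  note sp = smooth_path_of_curve [OF J \<gamma>]
  have unit: "unitary_operator (?W \<tau>)" if "\<tau> \<in> J" for \<tau>
    using quantum_evolution_unitary [OF quantum_path_evolution [OF h sp [OF that]]] by simp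
  have core: "?W t (\<psi> t) \<in> core Q h"
    using quantum_evolution_core [OF quantum_path_evolution [OF h sp [OF t]]] \<psi>(1) by simp
  define \<psi>' where "\<psi>' = vector_derivative \<psi> (at t)"
  have \<psi>': "(\<psi> has_vector_derivative \<psi>') (at t)"
    using \<psi>(2) by (simp add: \<psi>'_def vector_derivative_works)
  define K where "K = quantize Q h (path_ham h \<gamma> t) (?W t (\<psi> t))"
  have deriv_core: "((\<lambda>\<tau>. ?W \<tau> \<phi>) has_vector_derivative path_velocity h \<gamma> t (?W t \<phi>)) (at t)"
    if "\<phi> \<in> core Q h" for \<phi>
    by (rule quantum_path_derivative [OF h J \<gamma> t that])
  have "((\<lambda>\<tau>. ?W \<tau> (\<psi> \<tau>)) has_vector_derivative ?W t \<psi>' + path_velocity h \<gamma> t (?W t (\<psi> t))) (at t)"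
  proof (rule unitary_family_product_rule [OF _ _ core_closure [OF h] _ \<psi>'])
    show "\<forall>\<^sub>F \<tau> in at t. unitary_operator (?W \<tau>)"
      using eventually_at_in_open' [OF J(1) t] by eventually_elim (rule unit)
    show "((\<lambda>\<tau>. ?W \<tau> \<phi>) \<longlongrightarrow> ?W t \<phi>) (at t)" if "\<phi> \<in> core Q h" for \<phi>
      using has_vector_derivative_continuous [OF deriv_core [OF that]]
      by (simp add: continuous_within)
  qed (use unit t \<psi>(1) deriv_core in auto)
  moreover have "(e has_vector_derivative (- (\<i> / complex_of_real h) * complex_of_real E) * e t) (at t)"
  proof -
    have "((\<lambda>z. exp (- (\<i> / complex_of_real h) * (complex_of_real E * z))) has_field_derivative
      (- (\<i> / complex_of_real h) * complex_of_real E) * e t) (at (complex_of_real t))"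
      using \<open>h \<noteq> 0\<close> by (auto intro!: derivative_eq_intros simp: e_def)
    from has_vector_derivative_real_field [OF this] show ?thesis
      by (simp add: e_def)
  qed
  ultimately have main: "((\<lambda>\<tau>. e \<tau> *\<^sub>C ?W \<tau> (\<psi> \<tau>)) has_vector_derivative
      (e t *\<^sub>C (?W t \<psi>' + path_velocity h \<gamma> t (?W t (\<psi> t)))
        + ((- (\<i> / complex_of_real h) * complex_of_real E) * e t) *\<^sub>C ?W t (\<psi> t))) (at t)"
    by (intro scaleC.has_vector_derivative)
  then show "(\<lambda>\<tau>. e \<tau> *\<^sub>C ?W \<tau> (\<psi> \<tau>)) differentiable (at t)"
    by (rule differentiableI_vector)
  obtain g where g: "g \<in> symbols Q"
    "g h = quantum_pullback Q h \<gamma> t (\<lambda>w. f h w - 1/2 * path_ham h \<gamma> t w)"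
    "\<And>\<psi>. \<psi> \<in> core Q h \<Longrightarrow> quantize Q h (g h) \<psi> =
      inv (?W t) (quantize Q h (\<lambda>w. f h w - 1/2 * path_ham h \<gamma> t w) (?W t \<psi>))"
    using quantum_pullback_quantize [OF sp [OF t] symbols_diff [OF f path_ham_symbol] h] by blast
  have "quantize Q h (G t) (\<psi> t) = quantize Q h (g h) (\<psi> t) - complex_of_real E *\<^sub>C \<psi> t"
    using quantize_symbol_diff [OF g(1) symbols_one h, of "\<psi> t" "complex_of_real E"]
      quantize_one [OF h] \<psi>(1)
    by (simp add: G_def g(2))
  then have Gt: "?W t (quantize Q h (G t) (\<psi> t))
      = quantize Q h (f h) (?W t (\<psi> t)) - (1/2) *\<^sub>C K - complex_of_real E *\<^sub>C ?W t (\<psi> t)"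
    using quantize_symbol_diff [OF f path_ham_symbol h core, of "1/2"]
    by (simp add: g(3) \<psi>(1) t unitary_operator_diff unitary_operator_scaleC unitary_operator_inv
        unit K_def)
  have "time_operator h (\<lambda>_. quantize Q h (f h)) (\<lambda>\<tau>. e \<tau> *\<^sub>C ?W \<tau> (\<psi> \<tau>)) t
      = e t *\<^sub>C ((- \<i> * complex_of_real h) *\<^sub>C ?W t \<psi>' - (1/2) *\<^sub>C K
          - complex_of_real E *\<^sub>C ?W t (\<psi> t) + quantize Q h (f h) (?W t (\<psi> t)))"
    unfolding time_operator_def vector_derivative_at [OF main] quantize_vector_scale [OF f h core]
      path_velocity_def K_def [symmetric]
    using \<open>h \<noteq> 0\<close>
    by (simp add: scaleC.add_right scaleC.diff_right scaleC_scaleC scaleC.minus_left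
        scaleC.minus_right field_simps)
  also have "\<dots> = e t *\<^sub>C ?W t ((- \<i> * complex_of_real h) *\<^sub>C \<psi>' + quantize Q h (G t) (\<psi> t))"
    by (simp add: unitary_operator_add unitary_operator_scaleC unit t Gt diff_add_eq add_diff_eq)
  finally show "time_operator h (\<lambda>_. quantize Q h (f h)) (\<lambda>\<tau>. e \<tau> *\<^sub>C ?W \<tau> (\<psi> \<tau>)) t
      = e t *\<^sub>C ?W t (time_operator h (\<lambda>\<tau>. quantize Q h (G \<tau>)) \<psi> t)"
    by (simp add: time_operator_def \<psi>'_def)
qed


section \<open>The classical limit\<close>

lemma eventually_hbars: "(\<And>h. h \<in> hbars Q \<Longrightarrow> P h) \<Longrightarrow> \<forall>\<^sub>F h in at 0 within hbars Q. P h"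
  by (simp add: eventually_at_filter)

lemma open_crange: "c \<in> atlas Q \<Longrightarrow> open (crange c)"
  using atlas by (simp add: smooth_atlas_def)

lemma O_hbar2_iff_jets:
  "O_hbar2 Q F \<longleftrightarrow> (\<forall>\<^sub>F h in at 0 within hbars Q. smooth_fun (atlas Q) (F h)) \<and>
     (\<forall>c\<in>atlas Q. jets_O2 (at 0 within hbars Q) (crange c) (\<lambda>h u. F h (cinv c u)))"
  unfolding O_hbar2_def jets_O2_def comp_def by blast

lemma smooth_fun_chart: "smooth_fun (atlas Q) f \<Longrightarrow> c \<in> atlas Q \<Longrightarrow> smooth_on (crange c) (\<lambda>u. f (cinv c u))"
  by (simp add: smooth_fun_def comp_def)

lemma O_hbar2_smooth:
  assumes "O_hbar2 Q F"
  shows "\<forall>\<^sub>F h in at 0 within hbars Q. smooth_fun (atlas Q) (F h)"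
    and "c \<in> atlas Q \<Longrightarrow> \<forall>\<^sub>F h in at 0 within hbars Q. smooth_on (crange c) (\<lambda>u. F h (cinv c u))"
proof -
  show ev: "\<forall>\<^sub>F h in at 0 within hbars Q. smooth_fun (atlas Q) (F h)"
    using assms by (simp add: O_hbar2_iff_jets)
  show "\<forall>\<^sub>F h in at 0 within hbars Q. smooth_on (crange c) (\<lambda>u. F h (cinv c u))" if "c \<in> atlas Q"
    using ev by eventually_elim (rule smooth_fun_chart [OF _ that])
qed

lemma O_hbar2_jets:
  "O_hbar2 Q F \<Longrightarrow> c \<in> atlas Q \<Longrightarrow> jets_O2 (at 0 within hbars Q) (crange c) (\<lambda>h u. F h (cinv c u))"
  by (simp add: O_hbar2_iff_jets)

lemma O_hbar2_cong:
  assumes "\<And>h z. h \<in> hbars Q \<Longrightarrow> F h z = G h z" "O_hbar2 Q F"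
  shows "O_hbar2 Q G"
  unfolding O_hbar2_iff_jets
proof (intro conjI ballI)
  have eq: "\<forall>\<^sub>F h in at 0 within hbars Q. F h = G h"
    by (rule eventually_hbars) (simp add: fun_eq_iff assms(1))
  show "\<forall>\<^sub>F h in at 0 within hbars Q. smooth_fun (atlas Q) (G h)"
    using eq O_hbar2_smooth(1) [OF assms(2)] by eventually_elim simp
  show "jets_O2 (at 0 within hbars Q) (crange c) (\<lambda>h u. G h (cinv c u))" if c: "c \<in> atlas Q" for c
    by (rule jets_O2_cong [OF open_crange [OF c] _ O_hbar2_jets [OF assms(2) c]])
      (rule eventually_hbars, simp add: assms(1))
qed

lemma O_hbar2_add:
  assumes F: "O_hbar2 Q F" and G: "O_hbar2 Q G"
  shows "O_hbar2 Q (\<lambda>h z. F h z + G h z)"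
  unfolding O_hbar2_iff_jets
proof (intro conjI ballI)
  show "\<forall>\<^sub>F h in at 0 within hbars Q. smooth_fun (atlas Q) (\<lambda>z. F h z + G h z)"
    using O_hbar2_smooth(1) [OF F] O_hbar2_smooth(1) [OF G]
  proof eventually_elim
    case (elim h)
    show ?case
      unfolding smooth_fun_def comp_def
      by (intro ballI smooth_on_add open_crange smooth_fun_chart elim)
  qed
  show "jets_O2 (at 0 within hbars Q) (crange c) (\<lambda>h u. F h (cinv c u) + G h (cinv c u))"
    if c: "c \<in> atlas Q" for c
    by (intro jets_O2_add open_crange O_hbar2_smooth(2) O_hbar2_jets F G c)
qed

lemma O_hbar2_mult:
  assumes F: "O_hbar2 Q F"
  shows "O_hbar2 Q (\<lambda>h z. a * F h z)"
  unfolding O_hbar2_iff_jets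
proof (intro conjI ballI)
  show "\<forall>\<^sub>F h in at 0 within hbars Q. smooth_fun (atlas Q) (\<lambda>z. a * F h z)"
    using O_hbar2_smooth(1) [OF F]
  proof eventually_elim
    case (elim h)
    show ?case
      unfolding smooth_fun_def comp_def
      by (intro ballI smooth_on_linear [OF _ _ bounded_linear_mult_right] open_crange smooth_fun_chart elim)
  qed
  show "jets_O2 (at 0 within hbars Q) (crange c) (\<lambda>h u. a * F h (cinv c u))"
    if c: "c \<in> atlas Q" for c
    by (intro jets_O2_linear [OF _ _ _ bounded_linear_mult_right] open_crange O_hbar2_smooth(2)
        O_hbar2_jets F c)
qed

lemma O_hbar2_sum:
  assumes "finite S" "S \<noteq> {}" "\<And>k. k \<in> S \<Longrightarrow> O_hbar2 Q (F k)"
  shows "O_hbar2 Q (\<lambda>h z. \<Sum>k\<in>S. F k h z)"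
  using assms by (induction S rule: finite_ne_induct) (auto intro: O_hbar2_add)

text \<open>The intermediate step for composing with a smooth map: near each point of a chart, the map has a
  smooth coordinate expression with values in a single chart.\<close>

lemma smooth_map_in_charts:
  assumes \<sigma>: "smooth_map (atlas Q) \<sigma>" and a: "a \<in> atlas Q" and u: "u \<in> crange a"
  obtains b N \<phi> where "b \<in> atlas Q" "open N" "u \<in> N" "N \<subseteq> crange a" "smooth_on N \<phi>"
    "\<phi> ` N \<subseteq> crange b" "\<And>v. v \<in> N \<Longrightarrow> \<sigma> (cinv a v) = cinv b (\<phi> v)"
proof -
  have hom: "homeomorphism (cdom c) (crange c) (cmap c) (cinv c)" "open (cdom c)" if "c \<in> atlas Q" for c
    using atlas that by (simp_all add: smooth_atlas_def)
  define b where "b = chart_at Q (\<sigma> (cinv a u))"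
  have b: "b \<in> atlas Q" "\<sigma> (cinv a u) \<in> cdom b"
    by (simp_all add: b_def chart_at)
  define N where "N = cmap a ` (cdom a \<inter> \<sigma> -` cdom b)"
  have N: "N = cinv a -` (\<sigma> -` cdom b) \<inter> crange a"
  proof (intro subset_antisym subsetI)
    fix v assume "v \<in> N"
    then obtain x where x: "x \<in> cdom a" "\<sigma> x \<in> cdom b" "v = cmap a x"
      by (auto simp: N_def)
    with homeomorphism_apply1 [OF hom(1) [OF a] x(1)] show "v \<in> cinv a -` (\<sigma> -` cdom b) \<inter> crange a"
      by (simp add: crange_def)
  next
    fix v assume v: "v \<in> cinv a -` (\<sigma> -` cdom b) \<inter> crange a"
    then have "cmap a (cinv a v) = v" "cinv a v \<in> cdom a"
      using homeomorphism_apply2 [OF hom(1) [OF a]] homeomorphism_image2 [OF hom(1) [OF a]] by auto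
    with v show "v \<in> N"
      unfolding N_def by (metis IntD1 IntI image_eqI vimageE vimageI)
  qed
  have "open (\<sigma> -` cdom b)"
    using \<sigma> hom(2) [OF b(1)] by (simp add: smooth_map_def open_vimage)
  moreover have "continuous_on (crange a) (cinv a)"
    using hom(1) [OF a] by (simp add: homeomorphism_def)
  ultimately have "open N"
    unfolding N using continuous_on_open_vimage [OF open_crange [OF a]] by blast
  moreover have "smooth_on N (cmap b \<circ> \<sigma> \<circ> cinv a)"
    using \<sigma> a b(1) by (simp add: smooth_map_def N_def)
  moreover have "(cmap b \<circ> \<sigma> \<circ> cinv a) ` N \<subseteq> crange b"
    by (auto simp: N crange_def)
  moreover have "\<sigma> (cinv a v) = cinv b ((cmap b \<circ> \<sigma> \<circ> cinv a) v)" if "v \<in> N" for v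
    using that hom(1) [OF b(1)] by (simp add: N homeomorphism_def)
  ultimately show thesis
    using that [of b N "cmap b \<circ> \<sigma> \<circ> cinv a"] b u N by blast
qed

text \<open>Smoothness and the estimates are local, so both reduce to the coordinate expression of \<open>\<sigma>\<close>.\<close>

lemma O_hbar2_compose:
  assumes F: "O_hbar2 Q F" and \<sigma>: "smooth_map (atlas Q) \<sigma>"
  shows "O_hbar2 Q (\<lambda>h z. F h (\<sigma> z))"
  unfolding O_hbar2_iff_jets
proof (intro conjI ballI)
  show "\<forall>\<^sub>F h in at 0 within hbars Q. smooth_fun (atlas Q) (\<lambda>z. F h (\<sigma> z))"
    using O_hbar2_smooth(1) [OF F]
  proof eventually_elim
    case (elim h)
    show ?case
      unfolding smooth_fun_def comp_def
    proof (intro ballI smooth_on_local)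
      fix a u assume a: "a \<in> atlas Q" and u: "u \<in> crange a"
      obtain b N \<phi> where b: "b \<in> atlas Q" and N: "open N" "u \<in> N" "smooth_on N \<phi>" "\<phi> ` N \<subseteq> crange b"
        and eq: "\<And>v. v \<in> N \<Longrightarrow> \<sigma> (cinv a v) = cinv b (\<phi> v)"
        using smooth_map_in_charts [OF \<sigma> a u] by metis
      have "smooth_on N (\<lambda>v. F h (cinv b (\<phi> v)))"
        by (rule smooth_on_compose [OF N(1,3,4) smooth_fun_chart [OF elim b]])
      then have "smooth_on N (\<lambda>v. F h (\<sigma> (cinv a v)))"
        by (rule smooth_on_cong [OF N(1), rotated]) (simp add: eq)
      with N(2) show "\<exists>N. u \<in> N \<and> smooth_on N (\<lambda>v. F h (\<sigma> (cinv a v)))"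
        by blast
    qed
  qed
next
  fix a assume a: "a \<in> atlas Q"
  show "jets_O2 (at 0 within hbars Q) (crange a) (\<lambda>h u. F h (\<sigma> (cinv a u)))"
  proof (rule jets_O2_local)
    fix u assume u: "u \<in> crange a"
    obtain b N \<phi> where b: "b \<in> atlas Q" and N: "open N" "u \<in> N" "smooth_on N \<phi>" "\<phi> ` N \<subseteq> crange b"
      and eq: "\<And>v. v \<in> N \<Longrightarrow> \<sigma> (cinv a v) = cinv b (\<phi> v)"
      using smooth_map_in_charts [OF \<sigma> a u] by metis
    have "jets_O2 (at 0 within hbars Q) N (\<lambda>h v. F h (cinv b (\<phi> v)))"
      by (rule jets_O2_compose [OF N(1,3,4) O_hbar2_smooth(2) [OF F b] O_hbar2_jets [OF F b]])
    then have "jets_O2 (at 0 within hbars Q) N (\<lambda>h v. F h (\<sigma> (cinv a v)))"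
      by (rule jets_O2_cong [OF N(1), rotated]) (simp add: eq)
    with N(1,2) show "\<exists>N. open N \<and> u \<in> N \<and> jets_O2 (at 0 within hbars Q) N (\<lambda>h u. F h (\<sigma> (cinv a u)))"
      by blast
  qed
qed

lemma path_ham_classical:
  "O_hbar2 Q (\<lambda>h z. path_ham h \<gamma> t z - complex_of_real (contract_velocity Q (ether Q) \<gamma> t z))"
proof -
  let ?c = "chart_at Q (\<gamma> t)"
  have "O_hbar2 Q (\<lambda>h z. \<Sum>k\<in>UNIV. complex_of_real (velocity ?c \<gamma> t $ k) *
      (qether Q h ?c (\<gamma> t) z $ k - complex_of_real (ether Q ?c (\<gamma> t) z $ k)))"
    by (intro O_hbar2_sum O_hbar2_mult qether_classical chart_at) auto
  then show ?thesis
    by (rule O_hbar2_cong [rotated])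
      (simp add: path_ham_eq contract_velocity_def Let_def scaleR_conv_of_real right_diff_distrib
        sum_subtractf)
qed

text \<open>Two sources of the error: the remainder of the pullback, which the expansion delivers already composed
  with the symplectic path, and the replacement of the quantum by the classical intrinsic
  Hamiltonian inside the pulled-back function.\<close>

lemma quantum_pullback_classical:
  assumes \<gamma>: "smooth_path (atlas Q) \<gamma> t" and f: "f \<in> symbols Q"
  shows "O_hbar2 Q (\<lambda>h z. quantum_pullback Q h \<gamma> t (\<lambda>w. f h w - 1/2 * path_ham h \<gamma> t w) z
    - (f h (symplectic_path Q \<gamma> t z)
       - 1/2 * complex_of_real (contract_velocity Q (ether Q) \<gamma> t (symplectic_path Q \<gamma> t z))))"
proof -
  let ?\<sigma> = "symplectic_path Q \<gamma> t"
  obtain r where r: "O_hbar2 Q r" "\<And>h z. h \<in> hbars Q \<Longrightarrow>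
      quantum_pullback Q h \<gamma> t (\<lambda>w. f h w - 1/2 * path_ham h \<gamma> t w) z
      = f h (?\<sigma> z) - 1/2 * path_ham h \<gamma> t (?\<sigma> z) + r h (?\<sigma> z)"
    using quantum_pullback_expansion [OF \<gamma> symbols_diff [OF f path_ham_symbol]] by blast
  have "O_hbar2 Q (\<lambda>h z. r h z + (- 1/2) *
      (path_ham h \<gamma> t z - complex_of_real (contract_velocity Q (ether Q) \<gamma> t z)))"
    by (intro O_hbar2_add O_hbar2_mult path_ham_classical r(1))
  from O_hbar2_compose [OF this symplectic_path_smooth [OF \<gamma>]] show ?thesis
    by (rule O_hbar2_cong [rotated]) (simp only: r(2), simp add: algebra_simps)
qed

end

theorem theorem8p1:
  fixes Q :: "('x::{second_countable_topology, t2_space}, 'd::finite, 'h::complex_hilbert_space)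
                quantum_data"
    and H :: "'x \<Rightarrow> real"
    and X :: "real \<Rightarrow> 'x \<Rightarrow> 'x"
    and I :: "'x \<Rightarrow> real set"
  assumes "ether_quantization Q"
    and "smooth_fun (atlas Q) H"
    and "(\<lambda>h z. complex_of_real (H z)) \<in> symbols Q"
    and "hamilton_flow Q H I X"
  shows
    "(\<forall>h\<in>hbars Q. \<forall>y. \<forall>\<psi>. (\<forall>t\<in>I y. \<psi> t \<in> core Q h \<and> \<psi> differentiable (at t)) \<longrightarrow>
       (\<forall>t\<in>I y.
          (\<lambda>\<tau>. translocation Q H X h y \<tau> (\<psi> \<tau>)) differentiable (at t) \<and>
          time_operator h (\<lambda>\<tau>. quantize Q h (\<lambda>z. complex_of_real (H z)))
              (\<lambda>\<tau>. translocation Q H X h y \<tau> (\<psi> \<tau>)) t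
            = translocation Q H X h y t
                (time_operator h (\<lambda>\<tau>. quantize Q h (quantum_translocated_ham Q H X h y \<tau>)) \<psi> t)))
     \<and> (\<forall>y. \<forall>t\<in>I y. O_hbar2 Q
          (\<lambda>h z. quantum_translocated_ham Q H X h y t z
                   - complex_of_real (classical_translocated_ham Q H X y t z)))"
proof -
  interpret ether_quantization Q by fact
  have flow: "open (I y)" "is_interval (I y)" "0 \<in> I y" "smooth_curve (atlas Q) (I y) (\<lambda>t. X t y)" for y
    using assms(4) by (simp_all add: hamilton_flow_def)
  have ham: "quantum_translocated_ham Q H X h y \<tau> = (\<lambda>z. quantum_pullback Q h (\<lambda>\<tau>. X \<tau> y) \<tau>
      (\<lambda>w. complex_of_real (H w) - 1/2 * path_ham h (\<lambda>\<tau>. X \<tau> y) \<tau> w) z - complex_of_real (H y))"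
    for h y \<tau>
    by (simp add: fun_eq_iff quantum_translocated_ham_def path_ham_def)
  show ?thesis
  proof (intro conjI ballI allI impI)
    fix h y \<psi> t
    assume *: "h \<in> hbars Q" "\<forall>t\<in>I y. \<psi> t \<in> core Q h \<and> \<psi> differentiable (at t)" "t \<in> I y"
    have \<psi>: "\<psi> t \<in> core Q h" "\<psi> differentiable (at t)"
      using *(2,3) by simp_all
    note perm = permutation_formula [OF *(1) flow [of y] *(3) assms(3) \<psi>, of "H y"]
    show "(\<lambda>\<tau>. translocation Q H X h y \<tau> (\<psi> \<tau>)) differentiable (at t)"
      using perm(1) by (simp add: translocation_def)
    show "time_operator h (\<lambda>\<tau>. quantize Q h (\<lambda>z. complex_of_real (H z)))
              (\<lambda>\<tau>. translocation Q H X h y \<tau> (\<psi> \<tau>)) t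
            = translocation Q H X h y t
                (time_operator h (\<lambda>\<tau>. quantize Q h (quantum_translocated_ham Q H X h y \<tau>)) \<psi> t)"
      using perm(2) by (simp add: translocation_def ham)
  next
    fix y t assume "t \<in> I y"
    then have "smooth_path (atlas Q) (\<lambda>\<tau>. X \<tau> y) t"
      by (rule smooth_path_of_curve [OF flow])
    from quantum_pullback_classical [OF this assms(3)]
    show "O_hbar2 Q (\<lambda>h z. quantum_translocated_ham Q H X h y t z
                   - complex_of_real (classical_translocated_ham Q H X y t z))"
      by (rule O_hbar2_cong [rotated]) (simp add: ham classical_translocated_ham_def Let_def)
  qed
qed

end
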